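(* Let $n_0\ge 3$. For every $n\ge n_0$ let $(\xi_{ni},\eta_{ni})$, $1\le i\le n$, be independent bivariate Gaussian vectors with $\mathbf{E}\xi_{ni}=\mathbf{E}\eta_{ni}=0$, $\mathbf{E}\xi_{ni}^2=\mathbf{E}\eta_{ni}^2=1$ and correlation coefficients $$\rho_{ni}=1-\frac{m_n(i/n)}{\log n},\qquad 1\le i\le n,$$ where $m_n:[0,1]\to(0,\infty)$ satisfies $m_n(i/n)\le 2\log n$ for all $1\le i\le n$ and $n\ge n_0$. Assume that $$\lim_{n\to\infty}(\log n)^4\max_{1\le i\le n}m_n(i/n)=0.$$ Let $M_{n1}=\max_{1\le i\le n}\xi_{ni}$, $M_{n2}=\max_{1\le i\le n}\eta_{ni}$, $m_{n1}=\min_{1\le i\le n}\xi_{ni}$, $m_{n2}=\min_{1\le i\le n}\eta_{ni}$, and let $b_n$ be defined by $1-\Phi(b_n)=1/n$. For $(x_1,y_1),(x_2,y_2)\in\mathbb{R}^2$ put $$P_n=\mathbf{P}\Big(M_{n1}\le b_n+\tfrac{x_2}{b_n},\ M_{n2}\le b_n+\tfrac{y_2}{b_n},\ m_{n1}\le -b_n+\tfrac{x_1}{b_n},\ m_{n2}\le -b_n+\tfrac{y_1}{b_n}\Big).$$ Then for every $(x_1,y_1),(x_2,y_2)\in\mathbb{R}^2$, $$\lim_{n\to\infty}(4\log n)\Big(P_n-H_0(x_2,y_2)\widetilde H_0(x_1,y_1)\Big)$$ $$=\big\{[\min(x_2,y_2)]^2+2\min(x_2,y_2)\big\}e^{-\min(x_2,y_2)}H_0(x_2,y_2)\widetilde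 H_0(x_1,y_1)$$ $$\quad-\big\{[x_1^2-2x_1]e^{x_1}\Lambda(-x_1)+[y_1^2-2y_1]e^{y_1}\Lambda(-y_1)\big\}H_0(x_2,y_2)$$ $$\quad+\big\{[\max(x_1,y_1)]^2-2\max(x_1,y_1)\big\}e^{\max(x_1,y_1)}H_0(x_2,y_2)H_0(-x_1,-y_1).$$
   Context: $\log$ is the natural logarithm. $\Phi$ is the standard Gaussian distribution function, and $\Lambda(x)=\exp(-e^{-x})$. For $(x,y)\in\mathbb{R}^2$, $$H_0(x,y)=\Lambda(\min(x,y)),\qquad \widetilde H_0(x,y)=1-\Lambda(-x)-\Lambda(-y)+\Lambda(\min(-x,-y)).$$ *)

theory Defs
  imports "HOL-Probability.Probability"
begin

definition Phi :: "real \<Rightarrow> real" where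
  "Phi = cdf std_normal_distribution"

definition Gumbel :: "real \<Rightarrow> real" where
  "Gumbel x = exp (- exp (- x))"

definition H0 :: "real \<Rightarrow> real \<Rightarrow> real" where
  "H0 x y = Gumbel (min x y)"

definition H0_tilde :: "real \<Rightarrow> real \<Rightarrow> real" where
  "H0_tilde x y = 1 - Gumbel (- x) - Gumbel (- y) + Gumbel (min (- x) (- y))"

(* Point masses count as Gaussian (variance 0). *)
definition gaussian_rv :: "'a measure \<Rightarrow> ('a \<Rightarrow> real) \<Rightarrow> bool" where
  "gaussian_rv M X \<longleftrightarrow>
     (\<exists>\<mu> \<sigma>. \<sigma> > 0 \<and> distributed M lborel X (normal_density \<mu> \<sigma>)) \<or>
     (X \<in> borel_measurable M \<and> (\<exists>c. AE \<omega> in M. X \<omega> = c))"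

(* Joint Gaussianity: every linear combination of the two components is Gaussian.
   Unlike a definition by a density, this includes the degenerate vectors with
   correlation 1 or -1. *)
definition bivariate_gaussian :: "'a measure \<Rightarrow> ('a \<Rightarrow> real) \<Rightarrow> ('a \<Rightarrow> real) \<Rightarrow> bool" where
  "bivariate_gaussian M X Y \<longleftrightarrow> (\<forall>s t. gaussian_rv M (\<lambda>\<omega>. s * X \<omega> + t * Y \<omega>))"

definition covariance :: "'a measure \<Rightarrow> ('a \<Rightarrow> real) \<Rightarrow> ('a \<Rightarrow> real) \<Rightarrow> real" where
  "covariance M X Y =
     (\<integral>\<omega>. (X \<omega> - (\<integral>\<omega>'. X \<omega>' \<partial>M)) * (Y \<omega> - (\<integral>\<omega>'. Y \<omega>' \<partial>M)) \<partial>M)"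

definition correlation :: "'a measure \<Rightarrow> ('a \<Rightarrow> real) \<Rightarrow> ('a \<Rightarrow> real) \<Rightarrow> real" where
  "correlation M X Y = covariance M X Y / sqrt (covariance M X X * covariance M Y Y)"

end

theory Submission
  imports Defs "HOL-Real_Asymp.Real_Asymp"
begin

text \<open>The correlations are so close to \<open>1\<close> that \<open>\<eta>\<close> can be replaced by \<open>\<xi>\<close>: the events differ only if
  for some \<open>i\<close> one of the thresholds lies between \<open>\<xi>\<^sub>i\<close> and \<open>\<eta>\<^sub>i\<close>, and each such crossing has probability
  \<open>o(1 / (n log n))\<close>. What remains is the event \<open>max \<xi>\<^sub>i \<le> u\<close>, \<open>min \<xi>\<^sub>i \<le> v\<close> for independent standard
  normal variables, with probability \<open>\<Phi>(u)\<^sup>n - (\<Phi>(u) - \<Phi>(v))\<^sup>n\<close>; it is expanded by means of the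
  asymptotic series of Mills' ratio.\<close>

subsection \<open>The standard normal tail\<close>

text \<open>The assumption makes the distance of the correlation from 1, m / log n, eventually at
  most (log n)^(-5). A crossing of a level near b_n is split at an overshoot of size (log n)^(-2).
  Smaller overshoots are controlled by the density at the level, which exceeds the tail, of order 1
  / n, by a factor of order b_n, about sqrt (2 log n); they have probability O((log n)^(-3/2) / n).
  Larger ones are amplified by t = (log n)^2, which moves the level by 1, while the variance grows
  by twice that distance times t + t^2, that is by O(1 / log n). The level being of order sqrt (log
  n), this inflation changes the Gaussian exponent by a bounded amount only, against a gain of order
  b_n from the shift. In the expansion, the 1 / b^2 terms of Mills' ratio at b + x/b and at b
  cancel; the coefficient x^2/2 + x stems from the square in the Gaussian exponent and the quotient
  b / (b + x/b) alone. As b_n^2 is asymptotic to 2 log n, the scale 4 log n doubles it.\<close>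

definition normal_tail :: "real \<Rightarrow> real" where
  "normal_tail u = measure std_normal_distribution {u..}"

abbreviation phi :: "real \<Rightarrow> real" where
  "phi \<equiv> std_normal_density"

lemma emeasure_std_normal_singleton: "emeasure std_normal_distribution {u} = 0"
  by (simp add: emeasure_density nn_integral_indicator_singleton)

lemma prob_space_std_normal: "prob_space std_normal_distribution"
  by (rule prob_space_normal_density) simp

lemma normal_tail_eq: "normal_tail u = 1 - Phi u"
proof -
  interpret prob_space std_normal_distribution by (rule prob_space_std_normal)
  have "{u..} = space std_normal_distribution - {..<u}" by auto
  then have "normal_tail u = 1 - prob {..<u}"
    unfolding normal_tail_def by (subst prob_compl[symmetric]) auto
  moreover have "prob {..u} = prob {..<u} + prob {u}"
    by (subst finite_measure_Union[symmetric]) (auto intro!: arg_cong[of _ _ prob])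
  moreover have "prob {u} = 0"
    using emeasure_std_normal_singleton by (simp add: measure_def)
  ultimately show ?thesis by (simp add: Phi_def cdf_def)
qed

lemma normal_tail_antimono: "u \<le> v \<Longrightarrow> normal_tail v \<le> normal_tail u"
proof -
  interpret prob_space std_normal_distribution by (rule prob_space_std_normal)
  show "u \<le> v \<Longrightarrow> normal_tail v \<le> normal_tail u"
    unfolding normal_tail_def by (rule finite_measure_mono) auto
qed

section \<open>Two-sided bounds for Mills' ratio\<close>

lemma DERIV_std_normal_density: "DERIV phi x :> - x * phi x"
  unfolding std_normal_density_def
  by (auto intro!: derivative_eq_intros simp: field_simps)

lemma DERIV_inverse_power:
  fixes x :: real
  assumes "x \<noteq> 0"
  shows "DERIV (\<lambda>y. 1 / y^k) x :> - real k / x^(k+1)"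
proof (cases k)
  case (Suc j)
  have "DERIV (\<lambda>y. inverse (y^k)) x :> - (inverse (x^k) * (real k * x^j) * inverse (x^k))"
    by (rule derivative_eq_intros refl | use assms Suc in simp)+
  also have "(\<lambda>y::real. inverse (y^k)) = (\<lambda>y. 1 / y^k)" by (simp add: inverse_eq_divide)
  finally show ?thesis
    by (rule DERIV_cong) (use assms Suc in \<open>simp add: field_simps\<close>)
qed simp

lemma normal_tail_nn_integral:
  "ennreal (normal_tail u) = (\<integral>\<^sup>+x. ennreal (phi x) * indicator {u..} x \<partial>lborel)"
proof -
  interpret prob_space std_normal_distribution by (rule prob_space_std_normal)
  show ?thesis
    unfolding normal_tail_def emeasure_eq_measure[symmetric]
    by (simp add: emeasure_density)
qed

text \<open>\<open>F\<close> is minus the density times the Mills series cut after three terms. Its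
  derivative \<open>phi x * (1 + 15 / x^6)\<close> dominates the density and \<open>F\<close>
  vanishes at infinity, so \<open>- F u\<close> dominates the tail.\<close>

lemma normal_tail_le:
  assumes "u > 0"
  shows "normal_tail u \<le> phi u * (1/u - 1/u^3 + 3/u^5)"
proof -
  define F where "F x = - phi x * (1/x - 1/x^3 + 3/x^5)" for x
  have "ennreal (normal_tail u) \<le> (\<integral>\<^sup>+x. ennreal (phi x * (1 + 15 / x^6)) * indicator {u..} x \<partial>lborel)"
    unfolding normal_tail_nn_integral
    by (intro nn_integral_mono) (auto split: split_indicator intro!: ennreal_leI simp: algebra_simps)
  also have "\<dots> = ennreal (0 - F u)"
  proof (rule nn_integral_FTC_atLeast)
    fix x assume "u \<le> x"
    with assms have x: "x > 0" by simp
    show "DERIV F x :> phi x * (1 + 15 / x^6)"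
    proof -
      have "DERIV (\<lambda>y. 1/y - 1/y^3 + 3/y^5) x :> - 1/x^2 + 3/x^4 - 15/x^6"
        using x DERIV_add[OF DERIV_diff[OF DERIV_inverse_power[of x 1] DERIV_inverse_power[of x 3]] DERIV_cmult[OF DERIV_inverse_power[of x 5], of 3]] by (simp add: power2_eq_square)
      from DERIV_mult[OF DERIV_minus[OF DERIV_std_normal_density] this] show ?thesis
        unfolding F_def
        by (rule DERIV_cong) (use x in \<open>simp add: field_simps eval_nat_numeral\<close>)
    qed
    show "0 \<le> phi x * (1 + 15 / x^6)" by (simp add: )
  next
    show "(F \<longlongrightarrow> 0) at_top"
      unfolding F_def std_normal_density_def by real_asymp
  qed measurable
  finally have *: "ennreal (normal_tail u) \<le> ennreal (- F u)" by simp
  have "normal_tail u > 0 \<or> normal_tail u = 0" 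
    unfolding normal_tail_def using measure_nonneg less_eq_real_def by metis
  \<comment> \<open>\<open>ennreal\<close> sends negative reals to \<open>0\<close>, so the
    inequality descends to the reals only with this sign. The square comes from completing
    \<open>u^4 - u^2 + 3\<close>.\<close>
  moreover have "0 \<le> - F u"
  proof -
    have "1/u - 1/u^3 + 3/u^5 = ((u^2 - 1/2)^2 + 11/4) / u^5"
      using assms by (simp add: field_simps eval_nat_numeral)
    also have "\<dots> \<ge> 0" using assms by (intro divide_nonneg_pos add_nonneg_nonneg) auto
    finally show ?thesis by (simp add: F_def)
  qed
  ultimately have "normal_tail u \<le> - F u" using * by (simp add: ennreal_le_iff)
  then show ?thesis by (simp add: F_def)
qed

text \<open>Cutting the series one term earlier flips the sign of the remainder: the derivative
  \<open>phi x * (1 - 3 / x^4)\<close> lies below the density. From \<open>2\<close> on it is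
  nonnegative, as the integration theorem for nonnegative functions requires.\<close>

lemma normal_tail_ge:
  assumes "u \<ge> 2"
  shows "phi u * (1/u - 1/u^3) \<le> normal_tail u"
proof -
  define F where "F x = - phi x * (1/x - 1/x^3)" for x
  have "ennreal (0 - F u) = (\<integral>\<^sup>+x. ennreal (phi x * (1 - 3 / x^4)) * indicator {u..} x \<partial>lborel)"
  proof (rule nn_integral_FTC_atLeast[symmetric])
    fix x assume "u \<le> x"
    with assms have x: "x \<ge> 2" by simp
    then have x0: "x > 0" by simp
    show "DERIV F x :> phi x * (1 - 3 / x^4)"
    proof -
      have "DERIV (\<lambda>y. 1/y - 1/y^3) x :> - 1/x^2 + 3/x^4"
        using x0 DERIV_diff[OF DERIV_inverse_power[of x 1] DERIV_inverse_power[of x 3]] by (simp add: power2_eq_square)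
      from DERIV_mult[OF DERIV_minus[OF DERIV_std_normal_density] this] show ?thesis
        unfolding F_def
        by (rule DERIV_cong) (use x0 in \<open>simp add: field_simps eval_nat_numeral\<close>)
    qed
    have "2^4 \<le> x^4" using x by (intro power_mono) auto
    then have "3 / x^4 \<le> 1" by (simp add: divide_simps)
    then show "0 \<le> phi x * (1 - 3 / x^4)" by simp
  next
    show "(F \<longlongrightarrow> 0) at_top"
      unfolding F_def std_normal_density_def by real_asymp
  qed measurable
  also have "\<dots> \<le> ennreal (normal_tail u)"
    unfolding normal_tail_nn_integral
    by (intro nn_integral_mono) (auto split: split_indicator intro!: ennreal_leI simp: algebra_simps)
  finally have "- F u \<le> normal_tail u"
    using measure_nonneg[of std_normal_distribution "{u..}"]
    by (simp add: ennreal_le_iff normal_tail_def)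
  then show ?thesis by (simp add: F_def)
qed

text \<open>The lower bound is available from \<open>2\<close> on, and smaller arguments have a
  larger tail.\<close>

lemma normal_tail_pos: "normal_tail u > 0"
proof -
  define v where "v = max u 2"
  have "v \<ge> 2" "u \<le> v" by (auto simp: v_def)
  have "0 < phi v * (1/v - 1/v^3)"
  proof (rule mult_pos_pos)
    show "0 < phi v" by (simp add: normal_density_pos)
    have "v^3 > v" using \<open>v \<ge> 2\<close> by (intro power_strict_increasing[of 1 3 v, simplified]) auto
    then show "0 < 1/v - 1/v^3" using \<open>v \<ge> 2\<close> by (simp add: divide_simps)
  qed
  also have "\<dots> \<le> normal_tail v" using \<open>v \<ge> 2\<close> by (rule normal_tail_ge)
  also have "\<dots> \<le> normal_tail u" using \<open>u \<le> v\<close> by (rule normal_tail_antimono)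
  finally show ?thesis .
qed

text \<open>Mills' ratio relative to its leading term \<open>1 / u\<close>. Dividing out
  \<open>phi u / u\<close> leaves a factor close to \<open>1\<close>, so the exponential part of a
  quotient of tails can be computed exactly.\<close>

definition mills_corr :: "real \<Rightarrow> real" where
  "mills_corr u = normal_tail u / (phi u / u)"

lemma normal_tail_eq_mills: "u > 0 \<Longrightarrow> normal_tail u = phi u / u * mills_corr u"
  using normal_density_pos[of 1 0 u] by (simp add: mills_corr_def)

lemma mills_corr_bounds:
  assumes "u \<ge> 2"
  shows "1 - 1/u^2 \<le> mills_corr u" "mills_corr u \<le> 1 - 1/u^2 + 3/u^4"
proof -
  have p: "phi u > 0" by (simp add: normal_density_pos)
  have "phi u / u * (1 - 1/u^2) = phi u * (1/u - 1/u^3)"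
    using assms by (simp add: field_simps eval_nat_numeral)
  then show "1 - 1/u^2 \<le> mills_corr u"
    using normal_tail_ge[OF assms] p assms unfolding mills_corr_def
    by (subst pos_le_divide_eq) (auto simp: mult.commute)
  have "phi u / u * (1 - 1/u^2 + 3/u^4) = phi u * (1/u - 1/u^3 + 3/u^5)"
    using assms by (simp add: field_simps eval_nat_numeral)
  then show "mills_corr u \<le> 1 - 1/u^2 + 3/u^4"
    using normal_tail_le[of u] p assms unfolding mills_corr_def
    by (subst pos_divide_le_eq) (auto simp: mult.commute)
qed

lemma mills_corr_tendsto: "(mills_corr \<longlongrightarrow> 1) at_top"
proof (rule tendsto_sandwich)
  show "\<forall>\<^sub>F u in at_top. 1 - 1/u^2 \<le> mills_corr u"
    using eventually_ge_at_top[of "2::real"] by eventually_elim (rule mills_corr_bounds)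
  show "\<forall>\<^sub>F u in at_top. mills_corr u \<le> 1 - 1/u^2 + 3/u^4"
    using eventually_ge_at_top[of "2::real"] by eventually_elim (rule mills_corr_bounds)
  show "((\<lambda>u. 1 - 1/u^2 :: real) \<longlongrightarrow> 1) at_top" by real_asymp
  show "((\<lambda>u. 1 - 1/u^2 + 3/u^4 :: real) \<longlongrightarrow> 1) at_top" by real_asymp
qed

text \<open>This is where the upper bound has to reach the term \<open>3 / u^4\<close>: the two
  bounds then differ by less than order \<open>u^(-2)\<close> and share their limit after
  scaling.\<close>

lemma mills_corr_second_order: "((\<lambda>u. u^2 * (mills_corr u - 1)) \<longlongrightarrow> -1) at_top"
proof (rule tendsto_sandwich)
  show "\<forall>\<^sub>F u in at_top. u^2 * ((1 - 1/u^2) - 1) \<le> u^2 * (mills_corr u - 1)"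
    using eventually_ge_at_top[of "2::real"]
    by eventually_elim (intro mult_left_mono diff_right_mono mills_corr_bounds, auto)
  show "\<forall>\<^sub>F u in at_top. u^2 * (mills_corr u - 1) \<le> u^2 * ((1 - 1/u^2 + 3/u^4) - 1)"
    using eventually_ge_at_top[of "2::real"]
    by eventually_elim (intro mult_left_mono diff_right_mono mills_corr_bounds, auto)
  show "((\<lambda>u::real. u^2 * ((1 - 1/u^2) - 1)) \<longlongrightarrow> -1) at_top" by real_asymp
  show "((\<lambda>u::real. u^2 * ((1 - 1/u^2 + 3/u^4) - 1)) \<longlongrightarrow> -1) at_top" by real_asymp
qed

text \<open>The ratio factors as \<open>h b * r b\<close>, with \<open>h\<close> explicit and
  \<open>r\<close> a quotient of two Mills corrections. Both corrections have the same
  \<open>1 / b^2\<close> coefficient, so \<open>r\<close> contributes nothing at this order and the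
  limit comes from \<open>h\<close> alone.\<close>

lemma normal_tail_shift_expansion:
  fixes x :: real
  shows "((\<lambda>b. b^2 * (normal_tail (b + x/b) / normal_tail b - exp (- x)))
           \<longlongrightarrow> - (x^2/2 + x) * exp (- x)) at_top"
proof -
  define r where "r b = mills_corr (b + x/b) / mills_corr b" for b
  define h where "h b = exp (- x - x^2 / (2 * b^2)) / (1 + x / b^2)" for b :: real
  have lim: "filterlim (\<lambda>b::real. b + x / b) at_top at_top" by real_asymp
  have m2: "((\<lambda>b. (b + x/b)^2 * (mills_corr (b + x/b) - 1)) \<longlongrightarrow> -1) at_top"
    by (rule filterlim_compose[OF mills_corr_second_order lim])
  have q: "((\<lambda>b. (b / (b + x/b))^2) \<longlongrightarrow> 1) at_top" by real_asymp
  \<comment> \<open>The squared quotient, which tends to \<open>1\<close>, converts the scaling by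
    \<open>(b + x/b)^2\<close> into one by \<open>b^2\<close>.\<close>
  have "((\<lambda>b. ((b / (b + x/b))^2 * ((b + x/b)^2 * (mills_corr (b + x/b) - 1))
            - b^2 * (mills_corr b - 1)) / mills_corr b) \<longlongrightarrow> (1 * (-1) - (-1)) / 1) at_top"
    by (intro tendsto_intros q m2 mills_corr_second_order mills_corr_tendsto) auto
  then have r2: "((\<lambda>b. b^2 * (r b - 1)) \<longlongrightarrow> 0) at_top"
  proof (rule Lim_transform_eventually[where f = "\<lambda>b. _ b", THEN tendsto_eq_rhs])
    have "\<forall>\<^sub>F b in at_top. mills_corr b > 0"
      using order_tendstoD(1)[OF mills_corr_tendsto, of 0] by simp
    moreover have "\<forall>\<^sub>F b in at_top. b + x / b > 0"
      using lim by (simp add: filterlim_at_top_dense)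
    ultimately show "\<forall>\<^sub>F b in at_top. ((b / (b + x/b))^2 * ((b + x/b)^2 * (mills_corr (b + x/b) - 1))
            - b^2 * (mills_corr b - 1)) / mills_corr b = b^2 * (r b - 1)"
    proof eventually_elim
      case (elim b)
      have "(b / (b + x/b))^2 * ((b + x/b)^2 * (mills_corr (b + x/b) - 1)) = b^2 * (mills_corr (b + x/b) - 1)"
        using elim by (simp add: power_divide)
      then show ?case using elim by (simp add: r_def field_simps)
    qed
  qed simp
  have h0: "(h \<longlongrightarrow> exp (-x)) at_top" unfolding h_def by real_asymp
  have h2: "((\<lambda>b. b^2 * (h b - exp (-x))) \<longlongrightarrow> - (x^2/2 + x) * exp (- x)) at_top"
  proof -
    \<comment> \<open>With \<open>s = 1 / b^2\<close> the scaled difference becomes a difference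
      quotient of \<open>g\<close> at \<open>0\<close>, so its limit is a derivative.\<close>
    define g where "g s = exp (- x - x^2 / 2 * s) / (1 + x * s)" for s :: real
    have "DERIV g 0 :> - (x^2/2 + x) * exp (- x)"
      unfolding g_def by (auto intro!: derivative_eq_intros simp: algebra_simps)
    then have "((\<lambda>s. (g s - g 0) / s) \<longlongrightarrow> - (x^2/2 + x) * exp (- x)) (at 0)"
      by (simp add: DERIV_def)
    moreover have "filterlim (\<lambda>b::real. 1 / b^2) (at 0) at_top" by real_asymp
    ultimately have "((\<lambda>b. (g (1/b^2) - g 0) / (1/b^2)) \<longlongrightarrow> - (x^2/2 + x) * exp (- x)) at_top"
      by (rule filterlim_compose)
    then show ?thesis by (simp add: g_def h_def mult.commute)
  qed
  have "((\<lambda>b. h b * (b^2 * (r b - 1)) + b^2 * (h b - exp (-x)))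
           \<longlongrightarrow> exp (-x) * 0 + - (x^2/2 + x) * exp (- x)) at_top"
    by (intro tendsto_intros h0 h2 r2)
  then have "((\<lambda>b. b^2 * (h b * r b - exp (-x))) \<longlongrightarrow> - (x^2/2 + x) * exp (- x)) at_top"
    by (simp add: algebra_simps)
  then show ?thesis
  proof (rule Lim_transform_eventually)
    have "\<forall>\<^sub>F b in at_top. b + x / b > 0"
      using lim by (simp add: filterlim_at_top_dense)
    then show "\<forall>\<^sub>F b in at_top. b^2 * (h b * r b - exp (-x))
        = b^2 * (normal_tail (b + x/b) / normal_tail b - exp (- x))"
      using eventually_gt_at_top[of 0]
    proof eventually_elim
      case (elim b)
      have "- ((b + x/b)^2 / 2) = - (b^2/2) + (- x - x^2 / (2 * b^2))"
        using elim by (simp add: field_simps power2_eq_square)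
      then have "phi (b + x/b) = phi b * exp (- x - x^2 / (2 * b^2))"
        unfolding std_normal_density_def by (simp add: exp_add[symmetric] del: minus_add_distrib)
      moreover have "b / (b + x/b) = 1 / (1 + x / b^2)"
        using elim by (simp add: field_simps power2_eq_square)
      ultimately have "h b = (phi (b + x/b) / phi b) * (b / (b + x/b))"
        using normal_density_pos[of 1 0 b] by (simp add: h_def)
      then have "normal_tail (b + x/b) / normal_tail b = h b * r b"
        using elim by (simp add: normal_tail_eq_mills r_def mult_ac)
      then show ?case by simp
    qed
  qed
qed

text \<open>In \<open>ln (normal_tail b)\<close> the term \<open>- b^2 / 2\<close> dominates
  \<open>ln b\<close> and the constants. At the level where the tail is 1 / n this says that b^2 is
  asymptotic to 2 log n, which converts the logarithmic scale into powers of b.\<close>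

lemma ln_normal_tail_asymp: "((\<lambda>b. 2 * - ln (normal_tail b) / b^2) \<longlongrightarrow> 1) at_top"
proof -
  define f where "f b = 1 + 2 * ln b / b^2 + 2 * ln (sqrt (2 * pi)) / b^2" for b :: real
  have "((\<lambda>b. f b - 2 * ln (mills_corr b) * (1 / b^2)) \<longlongrightarrow> 1 - 2 * ln 1 * 0) at_top"
  proof (intro tendsto_intros mills_corr_tendsto)
    show "(f \<longlongrightarrow> 1) at_top" unfolding f_def by real_asymp
    show "((\<lambda>b::real. 1 / b^2) \<longlongrightarrow> 0) at_top" by real_asymp
  qed auto
  then show ?thesis
  proof (rule Lim_transform_eventually[THEN tendsto_eq_rhs])
    have "\<forall>\<^sub>F b in at_top. mills_corr b > 0"
      using order_tendstoD(1)[OF mills_corr_tendsto, of 0] by simp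
    then show "\<forall>\<^sub>F b in at_top. f b - 2 * ln (mills_corr b) * (1 / b^2) = 2 * - ln (normal_tail b) / b^2"
      using eventually_gt_at_top[of 0]
    proof eventually_elim
      case (elim b)
      have "ln (phi b) = - ln (sqrt (2 * pi)) - b^2 / 2"
        by (simp add: std_normal_density_def ln_mult ln_div)
      moreover have "phi b > 0" by (simp add: normal_density_pos)
      ultimately have "ln (normal_tail b) = - ln (sqrt (2 * pi)) - b^2 / 2 - ln b + ln (mills_corr b)"
        using elim by (simp add: normal_tail_eq_mills ln_mult ln_div)
      then have "2 * - ln (normal_tail b)
          = b^2 + 2 * ln b + 2 * ln (sqrt (2 * pi)) - 2 * ln (mills_corr b)"
        by simp
      then show ?case
        using elim by (simp only: f_def add_divide_distrib diff_divide_distrib) simp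
    qed
  qed simp
qed

subsection \<open>Extremes under Gumbel norming\<close>

text \<open>n * ln (1 - p) differs from - n * p by O((n * p)^2 / n), and the condition on
  \<open>L n / real n\<close> keeps this negligible after multiplication by \<open>L n\<close>. The
  rate then passes through the exponential with its derivative at \<open>- \<tau>\<close>.\<close>

lemma power_one_minus_expansion:
  fixes p L :: "nat \<Rightarrow> real"
  assumes np: "(\<lambda>n. real n * p n) \<longlonglongrightarrow> \<tau>"
    and Lnp: "(\<lambda>n. L n * (real n * p n - \<tau>)) \<longlonglongrightarrow> c"
    and Ln: "(\<lambda>n. L n / real n) \<longlonglongrightarrow> 0"
  shows "(\<lambda>n. L n * ((1 - p n) ^ n - exp (- \<tau>))) \<longlonglongrightarrow> - c * exp (- \<tau>)"
proof -
  have "(\<lambda>n. (real n * p n) * (1 / real n)) \<longlonglongrightarrow> \<tau> * 0"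
    by (intro tendsto_mult np) real_asymp
  then have p0: "p \<longlonglongrightarrow> 0"
    by (rule Lim_transform_eventually[THEN tendsto_eq_rhs])
       (use eventually_gt_at_top[of 0] in \<open>eventually_elim, simp\<close>, simp)
  have small: "\<forall>\<^sub>F n in sequentially. \<bar>p n\<bar> \<le> 1/2"
    using tendstoD[OF p0, of "1/2"] by (auto elim!: eventually_mono)
  define a where "a n = real n * ln (1 - p n)" for n
  \<comment> \<open>The first estimate gives the limit of \<open>a\<close>, the second its rate;
    \<open>L\<close> may be small or large, so neither follows from the other.\<close>
  have aux: "\<forall>\<^sub>F n in sequentially. norm (a n + real n * p n) \<le> norm (2 * (real n * p n)^2 * (1 / real n))
           \<and> norm (L n * (a n + real n * p n)) \<le> norm (2 * (real n * p n)^2 * (L n / real n))"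
    using small eventually_gt_at_top[of 0]
  proof eventually_elim
    case (elim n)
    have "\<bar>ln (1 + (- p n)) - (- p n)\<bar> \<le> 2 * (- p n)^2"
      using elim by (intro abs_ln_one_plus_x_minus_x_bound) auto
    then have "real n * \<bar>ln (1 - p n) + p n\<bar> \<le> real n * (2 * (p n)^2)"
      by (intro mult_left_mono) auto
    moreover have "a n + real n * p n = real n * (ln (1 - p n) + p n)"
      by (simp add: a_def algebra_simps)
    moreover have "real n * (2 * (p n)^2) = 2 * (real n * p n)^2 * (1 / real n)"
      using elim by (simp add: power2_eq_square)
    ultimately have *: "\<bar>a n + real n * p n\<bar> \<le> 2 * (real n * p n)^2 * (1 / real n)"
      by (simp add: abs_mult)
    then have "\<bar>L n\<bar> * \<bar>a n + real n * p n\<bar> \<le> \<bar>L n\<bar> * (2 * (real n * p n)^2 * (1 / real n))"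
      by (intro mult_left_mono) auto
    with * show ?case by (simp add: abs_mult mult_ac)
  qed
  have "(\<lambda>n. 2 * (real n * p n)^2 * (1 / real n)) \<longlonglongrightarrow> 2 * \<tau>^2 * 0"
    by (intro tendsto_intros np)
  then have "(\<lambda>n. norm (2 * (real n * p n)^2 * (1 / real n))) \<longlonglongrightarrow> 0"
    by (intro tendsto_norm_zero) simp
  with eventually_mono[OF aux conjunct1] have d0: "(\<lambda>n. a n + real n * p n) \<longlonglongrightarrow> 0"
    by (rule Lim_null_comparison)
  have "(\<lambda>n. 2 * (real n * p n)^2 * (L n / real n)) \<longlonglongrightarrow> 2 * \<tau>^2 * 0"
    by (intro tendsto_intros np Ln)
  then have "(\<lambda>n. norm (2 * (real n * p n)^2 * (L n / real n))) \<longlonglongrightarrow> 0"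
    by (intro tendsto_norm_zero) simp
  with eventually_mono[OF aux conjunct2] have d1: "(\<lambda>n. L n * (a n + real n * p n)) \<longlonglongrightarrow> 0"
    by (rule Lim_null_comparison)
  have a: "a \<longlonglongrightarrow> - \<tau>" using tendsto_diff[OF d0 np] by simp
  have La: "(\<lambda>n. L n * (a n - (- \<tau>))) \<longlonglongrightarrow> - c"
    using tendsto_diff[OF d1 Lnp] by (simp add: algebra_simps)
  \<comment> \<open>In Caratheodory's form of the derivative, \<open>g\<close> replaces the
    difference quotient and stays meaningful when \<open>a n = - \<tau>\<close>.\<close>
  have "DERIV exp (- \<tau>) :> exp (- \<tau>)" by (rule DERIV_exp)
  then obtain g where g: "\<And>z. exp z - exp (- \<tau>) = g z * (z - (- \<tau>))"
      "isCont g (- \<tau>)" "g (- \<tau>) = exp (- \<tau>)"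
    unfolding CARAT_DERIV by blast
  have "(\<lambda>n. g (a n)) \<longlonglongrightarrow> exp (- \<tau>)"
    using isCont_tendsto_compose[OF g(2) a] g(3) by simp
  then have "(\<lambda>n. L n * (a n - (- \<tau>)) * g (a n)) \<longlonglongrightarrow> - c * exp (- \<tau>)"
    by (intro tendsto_mult La)
  then show ?thesis
  proof (rule Lim_transform_eventually)
    show "\<forall>\<^sub>F n in sequentially. L n * (a n - - \<tau>) * g (a n) = L n * ((1 - p n) ^ n - exp (- \<tau>))"
      using small
    proof eventually_elim
      case (elim n)
      then have "exp (a n) = (1 - p n) ^ n"
        by (simp add: a_def exp_of_nat_mult)
      then show ?case using g(1)[of "a n"] by (simp add: mult.commute mult.left_commute)
    qed
  qed
qed

section \<open>Smallness of the strip and of the inflated tail at level b\<close>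

lemma phi_quotient: "phi a / phi b = exp (b^2/2 - a^2/2)"
proof -
  have "exp (- (a^2) / 2) / exp (- (b^2) / 2) = exp (- (a^2) / 2 - - (b^2) / 2)"
    by (rule exp_diff[symmetric])
  also have "- (a^2) / 2 - - (b^2) / 2 = b^2/2 - a^2/2" by simp
  finally show ?thesis by (simp add: std_normal_density_def)
qed

lemma normal_tail_le_phi:
  assumes "u \<ge> 2" shows "normal_tail u \<le> phi u"
proof -
  have "mills_corr u \<le> 1 - 1/u^2 + 3/u^4" by (rule mills_corr_bounds) fact
  also have "\<dots> \<le> 2"
  proof -
    have "3 / u^4 \<le> 1" using power_mono[of 2 u 4] assms by (simp add: divide_simps)
    moreover have "0 \<le> 1 / u^2" by simp
    ultimately show ?thesis by linarith
  qed
  also have "\<dots> \<le> u" by fact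
  finally have "phi u * (mills_corr u / u) \<le> phi u * 1"
    using assms by (intro mult_left_mono) auto
  then show ?thesis using assms by (simp add: normal_tail_eq_mills)
qed

lemma normal_tail_ge_phi:
  assumes "u \<ge> 2" shows "phi u / (2 * u) \<le> normal_tail u"
proof -
  have "1 / 2 \<le> 1 - 1 / u^2"
    using power_mono[of 2 u 2] assms by (simp add: divide_simps)
  also have "\<dots> \<le> mills_corr u" by (rule mills_corr_bounds) fact
  finally have "phi u / u * (1/2) \<le> phi u / u * mills_corr u"
    using assms by (intro mult_left_mono) auto
  then show ?thesis using assms by (simp add: normal_tail_eq_mills)
qed

text \<open>A threshold raised by \<open>1\<close> gains a factor \<open>exp (- b)\<close>, while the variance inflation
  \<open>O(1 / b\<^sup>2)\<close> only costs a bounded factor. The constants come from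
  \<open>ln n \<ge> (b n)\<^sup>2 / 4\<close>, in \<open>crossing_bound_negligible\<close> below.\<close>

lemma inflated_tail_negligible:
  fixes x :: real
  shows "((\<lambda>b. b^2 * (normal_tail ((b + x/b + 1) / sqrt (1 + 2 * (64/b^6 + 4/b^2))) / normal_tail b))
           \<longlongrightarrow> 0) at_top"
proof -
  define w where "w b = (b + x/b + 1) / sqrt (1 + 2 * (64/b^6 + 4/b^2))" for b :: real
  have "filterlim w at_top at_top" unfolding w_def by real_asymp
  then have "\<forall>\<^sub>F b in at_top. w b \<ge> 2" by (simp add: filterlim_at_top)
  then have le: "\<forall>\<^sub>F b in at_top. norm (b^2 * (normal_tail (w b) / normal_tail b)) \<le> 2 * b^3 * exp (b^2/2 - (w b)^2/2)"
    using eventually_ge_at_top[of 2]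
  proof eventually_elim
    case (elim b)
    have p: "phi b > 0" by (simp add: normal_density_pos)
    have "normal_tail (w b) / normal_tail b \<le> phi (w b) / (phi b / (2 * b))"
      using elim p by (intro frac_le normal_tail_le_phi normal_tail_ge_phi) auto
    also have "\<dots> = 2 * b * exp (b^2/2 - (w b)^2/2)"
      by (simp flip: phi_quotient)
    finally have "b^2 * (normal_tail (w b) / normal_tail b) \<le> b^2 * (2 * b * exp (b^2/2 - (w b)^2/2))"
      by (intro mult_left_mono) auto
    moreover have "normal_tail (w b) / normal_tail b \<ge> 0"
      using normal_tail_pos[of "w b"] normal_tail_pos[of b] by (intro divide_nonneg_nonneg) auto
    ultimately show ?case
      using normal_tail_pos[of "w b"] normal_tail_pos[of b]
        elim by (simp add: power2_eq_square power3_eq_cube mult.assoc mult.left_commute[of b 2])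
  qed
  have "((\<lambda>b. 2 * b^3 * exp (b^2/2 - (w b)^2/2)) \<longlongrightarrow> 0) at_top"
    unfolding w_def by real_asymp
  with le show ?thesis unfolding w_def by (rule Lim_null_comparison)
qed

text \<open>\<open>phi b / normal_tail b\<close> is at most \<open>2 * b\<close>, and the shift by
  \<open>x / b\<close> changes the density by a bounded factor, so the whole is O(1 / b). The factor
  \<open>4 / b^2\<close> stands for the upper bound of 1 / log n.\<close>

lemma strip_negligible:
  fixes x :: real
  shows "((\<lambda>b. 4 / b^2 * (phi (b + x/b) / normal_tail b)) \<longlongrightarrow> 0) at_top"
proof -
  have le: "\<forall>\<^sub>F b in at_top. norm (4 / b^2 * (phi (b + x/b) / normal_tail b))
      \<le> 8 / b * exp (b^2/2 - (b + x/b)^2/2)"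
    using eventually_ge_at_top[of 2]
  proof eventually_elim
    case (elim b)
    have p: "phi b > 0" by (simp add: normal_density_pos)
    have "phi (b + x/b) / normal_tail b \<le> phi (b + x/b) / (phi b / (2 * b))"
      using elim p by (intro frac_le normal_tail_ge_phi) auto
    also have "\<dots> = 2 * b * exp (b^2/2 - (b + x/b)^2/2)"
      by (simp flip: phi_quotient)
    finally have "4 / b^2 * (phi (b + x/b) / normal_tail b) \<le> 4 / b^2 * (2 * b * exp (b^2/2 - (b + x/b)^2/2))"
      by (intro mult_left_mono) auto
    moreover have "phi (b + x/b) / normal_tail b \<ge> 0"
      using normal_tail_pos[of b] by (intro divide_nonneg_nonneg) auto
    ultimately show ?case using elim normal_tail_pos[of b] by (simp add: power2_eq_square abs_mult)
  qed
  have "((\<lambda>b. 8 / b * exp (b^2/2 - (b + x/b)^2/2)) \<longlongrightarrow> 0) at_top"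
    by real_asymp
  with le show ?thesis by (rule Lim_null_comparison)
qed

section \<open>Second-order expansions at the Gumbel norming constants\<close>

locale gumbel_norming =
  fixes b :: "nat \<Rightarrow> real"
  assumes normal_tail_b: "\<forall>\<^sub>F n in sequentially. normal_tail (b n) = 1 / real n"
begin

text \<open>If \<open>b n\<close> stayed below \<open>c\<close>, its tail \<open>1 / real n\<close>
  would be at least the positive number \<open>normal_tail c\<close>.\<close>

lemma filterlim_b: "filterlim b at_top sequentially"
  unfolding filterlim_at_top_dense
proof
  fix c :: real
  have "(\<lambda>n. 1 / real n) \<longlonglongrightarrow> 0" by real_asymp
  then have "\<forall>\<^sub>F n in sequentially. 1 / real n < normal_tail c"
    using normal_tail_pos order_tendstoD(2) by blast
  then show "\<forall>\<^sub>F n in sequentially. c < b n"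
    using normal_tail_b
  proof eventually_elim
    case (elim n)
    then show ?case using normal_tail_antimono[of "b n" c] by linarith
  qed
qed

lemma ln_asymp_b: "(\<lambda>n. 2 * ln (real n) / (b n)^2) \<longlonglongrightarrow> 1"
  using filterlim_compose[OF ln_normal_tail_asymp filterlim_b]
  by (rule Lim_transform_eventually)
     (use normal_tail_b eventually_gt_at_top[of 0] in \<open>eventually_elim, simp add: ln_div\<close>)

text \<open>Since n is the reciprocal of \<open>normal_tail (b n)\<close>, the product is the ratio
  of tails already expanded. The scale is \<open>2 * (b n)^2\<close> up to a factor tending to
  \<open>1\<close>, which doubles \<open>x^2/2 + x\<close>.\<close>

lemma tail_expansion:
  "(\<lambda>n. 4 * ln (real n) * (real n * normal_tail (b n + x / b n) - exp (- x)))
     \<longlonglongrightarrow> - (x^2 + 2 * x) * exp (- x)"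
proof -
  have "(\<lambda>n. 2 * (2 * ln (real n) / (b n)^2) *
      ((b n)^2 * (normal_tail (b n + x / b n) / normal_tail (b n) - exp (- x))))
     \<longlonglongrightarrow> 2 * 1 * (- (x^2/2 + x) * exp (- x))"
    by (intro tendsto_mult tendsto_const ln_asymp_b
        filterlim_compose[OF normal_tail_shift_expansion filterlim_b])
  then show ?thesis
  proof (rule Lim_transform_eventually[THEN tendsto_eq_rhs])
    have "\<forall>\<^sub>F n in sequentially. b n > 0"
      using filterlim_b by (simp add: filterlim_at_top_dense)
    then show "\<forall>\<^sub>F n in sequentially. 2 * (2 * ln (real n) / (b n)^2) *
      ((b n)^2 * (normal_tail (b n + x / b n) / normal_tail (b n) - exp (- x)))
      = 4 * ln (real n) * (real n * normal_tail (b n + x / b n) - exp (- x))"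
      using normal_tail_b by eventually_elim (simp add: mult.commute)
  qed (simp add: algebra_simps)
qed

lemma tail_limit: "(\<lambda>n. real n * normal_tail (b n + x / b n)) \<longlonglongrightarrow> exp (- x)"
proof -
  have "(\<lambda>n. 4 * ln (real n) * (real n * normal_tail (b n + x / b n) - exp (- x)) * (1 / (4 * ln (real n)))
      + exp (- x)) \<longlonglongrightarrow> - (x^2 + 2 * x) * exp (- x) * 0 + exp (- x)"
    by (intro tendsto_intros tendsto_mult[OF tail_expansion]) real_asymp
  then show ?thesis
    by (rule Lim_transform_eventually[THEN tendsto_eq_rhs])
       (use eventually_gt_at_top[of 1] in \<open>eventually_elim, simp\<close>, simp)
qed

text \<open>This is the crossing bound for one index, times the number of indices and the
  logarithmic scale. Writing n as \<open>1 / normal_tail B\<close> and comparing log n with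
  \<open>B^2\<close> turns the two summands into those of \<open>strip_negligible\<close> and
  \<open>inflated_tail_negligible\<close>.\<close>

lemma crossing_bound_negligible:
  "(\<lambda>n. real n * ln (real n) *
      (1 / ln (real n)^2 * phi (b n + x / b n)
       + normal_tail ((b n + x / b n + 1) / sqrt (1 + 2 * (1 / ln (real n)^3 + 1 / ln (real n))))))
   \<longlonglongrightarrow> 0"
proof (rule Lim_null_comparison)
  let ?w = "\<lambda>b. (b + x/b + 1) / sqrt (1 + 2 * (64/b^6 + 4/b^2))"
  let ?f = "\<lambda>b. 4 / b^2 * (phi (b + x/b) / normal_tail b) + b^2 * (normal_tail (?w b) / normal_tail b)"
  have "(?f \<longlongrightarrow> 0 + 0) at_top"
    by (intro tendsto_add strip_negligible inflated_tail_negligible)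
  from filterlim_compose[OF this filterlim_b]
  show "(\<lambda>n. ?f (b n)) \<longlonglongrightarrow> 0" by simp
  have lim: "filterlim (\<lambda>n. b n + x / b n + 1) at_top sequentially"
    by (rule filterlim_compose[OF _ filterlim_b]) real_asymp
  have ev: "\<forall>\<^sub>F n in sequentially. b n > 0" "\<forall>\<^sub>F n in sequentially. b n + x / b n + 1 > 0"
    using filterlim_b lim by (simp_all add: filterlim_at_top_dense)
  \<comment> \<open>The window from \<open>1/2\<close> to \<open>2\<close> around the limit
    \<open>1\<close> yields \<open>B^2 / 4 \<le> L\<close> and \<open>L \<le> B^2\<close>: the
    former controls \<open>1 / L\<close>, the latter the factor \<open>L\<close> in front of the
    inflated tail.\<close>
  have ln: "\<forall>\<^sub>F n in sequentially. 2 * ln (real n) / (b n)^2 > 1/2"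
     "\<forall>\<^sub>F n in sequentially. 2 * ln (real n) / (b n)^2 < 2"
    by (rule order_tendstoD[OF ln_asymp_b], simp)+
  show "\<forall>\<^sub>F n in sequentially. norm (real n * ln (real n) *
      (1 / ln (real n)^2 * phi (b n + x / b n)
       + normal_tail ((b n + x / b n + 1) / sqrt (1 + 2 * (1 / ln (real n)^3 + 1 / ln (real n)))))) \<le> ?f (b n)"
    using ev ln normal_tail_b eventually_gt_at_top[of 1]
  proof eventually_elim
    case (elim n)
    define L where "L = ln (real n)"
    define B where "B = b n"
    have B: "B > 0" "B + x / B + 1 > 0" using elim by (auto simp: B_def)
    have L: "B^2 / 4 \<le> L" "L \<le> B^2" "L > 0"
      using elim by (auto simp: B_def L_def field_simps)
    have n: "real n = 1 / normal_tail B" using elim by (simp add: B_def)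
    let ?wL = "(B + x / B + 1) / sqrt (1 + 2 * (1 / L^3 + 1 / L))"
    have iL: "1 / L \<le> 4 / B^2" using L B by (simp add: field_simps)
    then have "(1 / L)^3 \<le> (4 / B^2)^3" using L by (intro power_mono) auto
    then have iL3: "1 / L^3 \<le> 64 / B^6" by (simp add: power_divide flip: power_mult)
    have "?w B \<le> ?wL"
    proof (rule divide_left_mono)
      show "sqrt (1 + 2 * (1 / L^3 + 1 / L)) \<le> sqrt (1 + 2 * (64 / B^6 + 4 / B^2))"
        using iL iL3 by simp
      show "0 < sqrt (1 + 2 * (64 / B^6 + 4 / B^2)) * sqrt (1 + 2 * (1 / L^3 + 1 / L))"
        using L B by (intro mult_pos_pos) (auto intro!: add_pos_nonneg)
    qed (use B in auto)
    then have w: "normal_tail ?wL \<le> normal_tail (?w B)" by (rule normal_tail_antimono)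
    have "real n * L * (1 / L^2 * phi (B + x/B) + normal_tail ?wL)
        = 1 / L * (phi (B + x/B) / normal_tail B) + L * (normal_tail ?wL / normal_tail B)"
      unfolding n distrib_left using L by (simp add: power2_eq_square)
    also have "\<dots> \<le> ?f B"
      using iL w L normal_tail_pos[of B] normal_tail_pos[of ?wL]
      by (intro add_mono mult_mono divide_right_mono) auto
    finally have "real n * L * (1 / L^2 * phi (B + x/B) + normal_tail ?wL) \<le> ?f B" .
    moreover have "0 \<le> real n * L * (1 / L^2 * phi (B + x/B) + normal_tail ?wL)"
      using L normal_tail_pos[of ?wL] by (intro mult_nonneg_nonneg add_nonneg_nonneg) auto
    ultimately show ?case unfolding B_def L_def by simp
  qed
qed

lemma max_expansion:
  "(\<lambda>n. 4 * ln (real n) * ((1 - normal_tail (b n + x / b n)) ^ n - exp (- exp (- x))))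
     \<longlonglongrightarrow> (x^2 + 2 * x) * exp (- x) * exp (- exp (- x))"
proof -
  have "(\<lambda>n. 4 * ln (real n) / real n) \<longlonglongrightarrow> 0" by real_asymp
  from power_one_minus_expansion[OF tail_limit tail_expansion this]
  show ?thesis by (rule tendsto_eq_rhs) (simp add: algebra_simps)
qed

text \<open>By symmetry \<open>normal_tail (b n - z / b n)\<close> is the mass below
  \<open>- b n + z / b n\<close>, so the base of the power is the probability of staying between the
  two thresholds. The two tails expand separately, with shifts \<open>x\<close> and
  \<open>- z\<close>, and their expansions add.\<close>

lemma max_min_expansion:
  "(\<lambda>n. 4 * ln (real n) *
      ((1 - (normal_tail (b n + x / b n) + normal_tail (b n - z / b n))) ^ n - exp (- (exp (- x) + exp z))))
     \<longlonglongrightarrow> ((x^2 + 2 * x) * exp (- x) + (z^2 - 2 * z) * exp z) * exp (- (exp (- x) + exp z))"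
proof -
  define p where "p n = normal_tail (b n + x / b n) + normal_tail (b n - z / b n)" for n
  have "(\<lambda>n. real n * p n) \<longlonglongrightarrow> exp (- x) + exp z"
    using tendsto_add[OF tail_limit[of x] tail_limit[of "- z"]]
    by (simp add: p_def algebra_simps)
  moreover have "(\<lambda>n. 4 * ln (real n) * (real n * p n - (exp (- x) + exp z)))
      \<longlonglongrightarrow> - (x^2 + 2 * x) * exp (- x) - (z^2 - 2 * z) * exp z"
    using tendsto_add[OF tail_expansion[of x] tail_expansion[of "- z"]]
    by (simp add: p_def algebra_simps)
  moreover have "(\<lambda>n. 4 * ln (real n) / real n) \<longlonglongrightarrow> 0" by real_asymp
  ultimately have "(\<lambda>n. 4 * ln (real n) * ((1 - p n) ^ n - exp (- (exp (- x) + exp z))))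
     \<longlonglongrightarrow> - (- (x^2 + 2 * x) * exp (- x) - (z^2 - 2 * z) * exp z) * exp (- (exp (- x) + exp z))"
    by (rule power_one_minus_expansion)
  then show ?thesis unfolding p_def
    by (rule tendsto_eq_rhs) (simp add: algebra_simps)
qed

end

subsection \<open>Crossing probabilities\<close>

text \<open>The two moments determine the parameters of the density. A centred point mass has
  variance \<open>0\<close>, so \<open>v > 0\<close> excludes the degenerate alternative of
  \<open>gaussian_rv\<close>.\<close>

lemma (in prob_space) gaussian_rv_distributed:
  assumes Z: "gaussian_rv M Z" and mean: "expectation Z = 0"
    and var: "expectation (\<lambda>\<omega>. (Z \<omega>)^2) = v" and v: "v > 0"
  shows "distributed M lborel Z (normal_density 0 (sqrt v))"
  using Z unfolding gaussian_rv_def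
proof (elim disjE exE conjE)
  fix \<mu> \<sigma> :: real
  assume \<sigma>: "0 < \<sigma>" and D: "distributed M lborel Z (normal_density \<mu> \<sigma>)"
  have "\<mu> = 0" using normal_distributed_expectation[OF \<sigma> D] mean by simp
  moreover have "v = \<sigma>^2" using normal_distributed_variance[OF \<sigma> D] mean var by simp
  then have "sqrt v = \<sigma>" using \<sigma> by simp
  ultimately show ?thesis using D by simp
next
  fix c assume [measurable]: "Z \<in> borel_measurable M" and c: "AE \<omega> in M. Z \<omega> = c"
  have "expectation Z = expectation (\<lambda>_. c)"
    by (rule integral_cong_AE) (use c in auto)
  then have "c = 0" using mean prob_space by simp
  have "expectation (\<lambda>\<omega>. (Z \<omega>)^2) = expectation (\<lambda>_. 0)"
    by (rule integral_cong_AE) (use c \<open>c = 0\<close> in auto)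
  then show ?thesis using var v by simp
qed

lemma (in prob_space) std_normal_prob:
  assumes D: "distributed M lborel Z std_normal_density" and A: "A \<in> sets borel"
  shows "prob {\<omega> \<in> space M. Z \<omega> \<in> A} = measure std_normal_distribution A"
proof -
  have Z: "Z \<in> measurable M lborel" using D by (rule distributed_measurable)
  have "measure std_normal_distribution A = measure (distr M lborel Z) A"
    by (simp add: distributed_distr_eq_density[OF D])
  also have "\<dots> = prob (Z -` A \<inter> space M)" using Z A by (intro measure_distr) auto
  also have "Z -` A \<inter> space M = {\<omega> \<in> space M. Z \<omega> \<in> A}" by auto
  finally show ?thesis by simp
qed

lemma (in prob_space) centred_normal_tail:
  assumes D: "distributed M lborel Z (normal_density 0 \<sigma>)" and \<sigma>: "\<sigma> > 0"
  shows "prob {\<omega> \<in> space M. a \<le> Z \<omega>} = normal_tail (a / \<sigma>)"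
proof -
  have "distributed M lborel (\<lambda>\<omega>. (Z \<omega> - 0) / \<sigma>) std_normal_density"
    using D normal_standard_normal_convert[OF \<sigma>, of Z 0] by simp
  from std_normal_prob[OF this, of "{a / \<sigma>..}"] show ?thesis
    using \<sigma> by (simp add: normal_tail_def divide_le_cancel)
qed

text \<open>The density decreases on the nonnegative half-line, so its value at the left end bounds
  it on the strip.\<close>

lemma std_normal_strip_le:
  assumes "u \<ge> 0" "\<epsilon> \<ge> 0"
  shows "measure std_normal_distribution {u..u + \<epsilon>} \<le> \<epsilon> * phi u"
proof -
  interpret prob_space std_normal_distribution by (rule prob_space_std_normal)
  have "ennreal (prob {u..u + \<epsilon>}) = (\<integral>\<^sup>+x. ennreal (phi x) * indicator {u..u + \<epsilon>} x \<partial>lborel)"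
    unfolding emeasure_eq_measure[symmetric] by (simp add: emeasure_density)
  also have "\<dots> \<le> (\<integral>\<^sup>+x. ennreal (phi u) * indicator {u..u + \<epsilon>} x \<partial>lborel)"
  proof (rule nn_integral_mono)
    fix x
    show "ennreal (phi x) * indicator {u..u + \<epsilon>} x \<le> ennreal (phi u) * indicator {u..u + \<epsilon>} x"
    proof (cases "u \<le> x")
      case True
      then have "u^2 \<le> x^2" using assms by (intro power_mono) auto
      then have "phi x \<le> phi u" by (simp add: std_normal_density_def divide_right_mono)
      then show ?thesis by (intro mult_right_mono ennreal_leI) auto
    qed simp
  qed
  also have "\<dots> = ennreal (\<epsilon> * phi u)"
    using assms by (simp add: nn_integral_cmult_indicator ennreal_mult' mult.commute)
  finally show ?thesis using assms by (simp add: ennreal_le_iff)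
qed

text \<open>\<open>\<delta>\<close> is the distance of the correlation from \<open>1\<close>. The
  assumptions are invariant under exchanging \<open>X\<close> and \<open>Y\<close> and under a joint
  change of sign, so one estimate of an upward crossing covers all four kinds of crossing.\<close>

locale standard_gaussian_pair = prob_space M for M :: "'a measure" +
  fixes X Y :: "'a \<Rightarrow> real" and \<delta> :: real
  assumes gaussian: "bivariate_gaussian M X Y"
    and mean_X: "expectation X = 0" and mean_Y: "expectation Y = 0"
    and var_X: "expectation (\<lambda>\<omega>. (X \<omega>)^2) = 1" and var_Y: "expectation (\<lambda>\<omega>. (Y \<omega>)^2) = 1"
    and cov: "expectation (\<lambda>\<omega>. X \<omega> * Y \<omega>) = 1 - \<delta>"
begin

lemma gaussian_rv_lin: "gaussian_rv M (\<lambda>\<omega>. s * X \<omega> + t * Y \<omega>)"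
  using gaussian by (simp add: bivariate_gaussian_def)

lemma measurable_lin: "(\<lambda>\<omega>. s * X \<omega> + t * Y \<omega>) \<in> borel_measurable M"
  using gaussian_rv_lin[of s t] unfolding gaussian_rv_def
  by (auto dest: distributed_measurable)

lemma measurable_X [measurable]: "X \<in> borel_measurable M"
  using measurable_lin[of 1 0] by simp

lemma measurable_Y [measurable]: "Y \<in> borel_measurable M"
  using measurable_lin[of 0 1] by simp

text \<open>A function that is not integrable has Bochner integral \<open>0\<close>, so the value
  \<open>1\<close> forces integrability.\<close>

lemma integrable_X2 [simp]: "integrable M (\<lambda>\<omega>. (X \<omega>)^2)"
  using var_X not_integrable_integral_eq by fastforce

lemma integrable_Y2 [simp]: "integrable M (\<lambda>\<omega>. (Y \<omega>)^2)"
  using var_Y not_integrable_integral_eq by fastforce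

lemma integrable_X [simp]: "integrable M X" and integrable_Y [simp]: "integrable M Y"
  by (rule square_integrable_imp_integrable; simp)+

lemma integrable_XY [simp]: "integrable M (\<lambda>\<omega>. X \<omega> * Y \<omega>)"
proof (rule Bochner_Integration.integrable_bound)
  show "integrable M (\<lambda>\<omega>. (X \<omega>)^2 + (Y \<omega>)^2)" by simp
  have "norm (x * y) \<le> norm (x^2 + y^2)" for x y :: real
  proof -
    have "2 * \<bar>x * y\<bar> \<le> x^2 + y^2"
      using sum_squares_bound[of "\<bar>x\<bar>" "\<bar>y\<bar>"] by (simp add: abs_mult)
    then show ?thesis by simp
  qed
  then show "AE \<omega> in M. norm (X \<omega> * Y \<omega>) \<le> norm ((X \<omega>)^2 + (Y \<omega>)^2)" by simp
qed measurable

text \<open>The variable is \<open>(1 + t) * Y - t * X\<close>, a linear combination and hence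
  Gaussian. Its variance exceeds \<open>1\<close> only by \<open>\<delta>\<close> times a quadratic
  in \<open>t\<close>, so \<open>t\<close> may be large as long as \<open>\<delta> * t^2\<close> is
  small.\<close>

lemma tilted_distributed:
  assumes "\<delta> \<ge> 0" "t \<ge> 0"
  shows "distributed M lborel (\<lambda>\<omega>. Y \<omega> + t * (Y \<omega> - X \<omega>))
           (normal_density 0 (sqrt (1 + 2 * \<delta> * (t + t^2))))"
proof (rule gaussian_rv_distributed)
  have eq: "(\<lambda>\<omega>. Y \<omega> + t * (Y \<omega> - X \<omega>)) = (\<lambda>\<omega>. (- t) * X \<omega> + (1 + t) * Y \<omega>)"
    by (simp add: algebra_simps)
  show "gaussian_rv M (\<lambda>\<omega>. Y \<omega> + t * (Y \<omega> - X \<omega>))"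
    unfolding eq by (rule gaussian_rv_lin)
  show "expectation (\<lambda>\<omega>. Y \<omega> + t * (Y \<omega> - X \<omega>)) = 0"
    by (simp add: mean_X mean_Y)
  have "(\<lambda>\<omega>. (Y \<omega> + t * (Y \<omega> - X \<omega>))^2)
      = (\<lambda>\<omega>. t^2 * (X \<omega>)^2 + (1 + t)^2 * (Y \<omega>)^2 + (- 2 * t * (1 + t)) * (X \<omega> * Y \<omega>))"
    by (simp add: algebra_simps power2_eq_square)
  then have "expectation (\<lambda>\<omega>. (Y \<omega> + t * (Y \<omega> - X \<omega>))^2)
      = expectation (\<lambda>\<omega>. t^2 * (X \<omega>)^2 + (1 + t)^2 * (Y \<omega>)^2 + (- 2 * t * (1 + t)) * (X \<omega> * Y \<omega>))"
    by simp
  also have "\<dots> = t^2 * expectation (\<lambda>\<omega>. (X \<omega>)^2) + (1 + t)^2 * expectation (\<lambda>\<omega>. (Y \<omega>)^2)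
      + (- 2 * t * (1 + t)) * expectation (\<lambda>\<omega>. X \<omega> * Y \<omega>)"
    by simp
  also have "\<dots> = t^2 * 1 + (1 + t)^2 * 1 + (- 2 * t * (1 + t)) * (1 - \<delta>)"
    by (simp only: var_X var_Y cov)
  also have "\<dots> = 1 + 2 * \<delta> * (t + t^2)"
    by (simp add: algebra_simps power2_eq_square)
  finally show "expectation (\<lambda>\<omega>. (Y \<omega> + t * (Y \<omega> - X \<omega>))^2) = 1 + 2 * \<delta> * (t + t^2)" .
  show "0 < 1 + 2 * \<delta> * (t + t^2)"
    using assms by (intro add_pos_nonneg) auto
qed

lemma Y_distributed: "distributed M lborel Y std_normal_density"
  using gaussian_rv_distributed[of Y 1] gaussian_rv_lin[of 0 1] mean_Y var_Y by simp

text \<open>If \<open>Y\<close> overshoots \<open>u\<close> by more than \<open>\<epsilon>\<close> while \<open>X \<le> u\<close>, then the single Gaussian variable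
  \<open>Y + t * (Y - X)\<close> exceeds \<open>u + t * \<epsilon>\<close>; this avoids the joint law of \<open>X\<close> and \<open>Y\<close>.\<close>

lemma crossing_le:
  assumes "\<delta> \<ge> 0" "t \<ge> 0" "\<epsilon> \<ge> 0" "u \<ge> 0"
  shows "prob {\<omega> \<in> space M. X \<omega> \<le> u \<and> u \<le> Y \<omega>}
    \<le> \<epsilon> * phi u + normal_tail ((u + t * \<epsilon>) / sqrt (1 + 2 * \<delta> * (t + t^2)))"
proof -
  have "prob {\<omega> \<in> space M. X \<omega> \<le> u \<and> u \<le> Y \<omega>}
    \<le> prob ({\<omega> \<in> space M. Y \<omega> \<in> {u..u + \<epsilon>}} \<union> {\<omega> \<in> space M. u + t * \<epsilon> \<le> Y \<omega> + t * (Y \<omega> - X \<omega>)})"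
  proof (rule finite_measure_mono)
    have "u + t * \<epsilon> \<le> y + t * (y - x)" if "x \<le> u" "\<not> y \<le> u + \<epsilon>" for x y
      using that assms by (intro add_mono mult_left_mono) auto
    then show "{\<omega> \<in> space M. X \<omega> \<le> u \<and> u \<le> Y \<omega>} \<subseteq> {\<omega> \<in> space M. Y \<omega> \<in> {u..u + \<epsilon>}}
        \<union> {\<omega> \<in> space M. u + t * \<epsilon> \<le> Y \<omega> + t * (Y \<omega> - X \<omega>)}"
      unfolding atLeastAtMost_iff by blast
  qed measurable
  also have "\<dots> \<le> prob {\<omega> \<in> space M. Y \<omega> \<in> {u..u + \<epsilon>}}
      + prob {\<omega> \<in> space M. u + t * \<epsilon> \<le> Y \<omega> + t * (Y \<omega> - X \<omega>)}"
    by (rule measure_Un_le) measurable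
  also have "prob {\<omega> \<in> space M. Y \<omega> \<in> {u..u + \<epsilon>}} \<le> \<epsilon> * phi u"
    using std_normal_prob[OF Y_distributed, of "{u..u + \<epsilon>}"] std_normal_strip_le[of u \<epsilon>] assms by simp
  also have "prob {\<omega> \<in> space M. u + t * \<epsilon> \<le> Y \<omega> + t * (Y \<omega> - X \<omega>)}
      = normal_tail ((u + t * \<epsilon>) / sqrt (1 + 2 * \<delta> * (t + t^2)))"
    using assms by (intro centred_normal_tail tilted_distributed) (auto intro!: add_pos_nonneg)
  finally show ?thesis by simp
qed

text \<open>The choice \<open>t = L^2\<close>, \<open>\<epsilon> = 1 / L^2\<close> makes the
  amplified overshoot \<open>t * \<epsilon>\<close> equal to \<open>1\<close>, and the bound on
  \<open>\<delta>\<close> keeps the variance excess below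
  \<open>2 * (1 / L^3 + 1 / L)\<close>.\<close>

lemma crossing_le_log_scale:
  assumes "0 \<le> \<delta>" "L > 0" "\<delta> \<le> 1 / L^5" "u \<ge> 0"
  shows "prob {\<omega> \<in> space M. X \<omega> \<le> u \<and> u \<le> Y \<omega>}
    \<le> 1 / L^2 * phi u + normal_tail ((u + 1) / sqrt (1 + 2 * (1 / L^3 + 1 / L)))"
proof -
  have "\<delta> * (L^2 + (L^2)^2) \<le> 1 / L^5 * (L^2 + (L^2)^2)"
    using assms by (intro mult_right_mono) auto
  also have "\<dots> = 1 / L^3 + 1 / L"
    using assms by (simp add: field_simps eval_nat_numeral)
  finally have "1 + 2 * \<delta> * (L^2 + (L^2)^2) \<le> 1 + 2 * (1 / L^3 + 1 / L)" by simp
  moreover have "0 < 1 + 2 * \<delta> * (L^2 + (L^2)^2)"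
    using assms by (intro add_pos_nonneg) auto
  ultimately have "(u + 1) / sqrt (1 + 2 * (1 / L^3 + 1 / L))
      \<le> (u + 1) / sqrt (1 + 2 * \<delta> * (L^2 + (L^2)^2))"
    using assms by (intro divide_left_mono) auto
  then have "normal_tail ((u + 1) / sqrt (1 + 2 * \<delta> * (L^2 + (L^2)^2)))
      \<le> normal_tail ((u + 1) / sqrt (1 + 2 * (1 / L^3 + 1 / L)))"
    by (rule normal_tail_antimono)
  with crossing_le[of "L^2" "1 / L^2" u] show ?thesis using assms by simp
qed

lemma swap: "standard_gaussian_pair M Y X \<delta>"
proof
  show "bivariate_gaussian M Y X"
    unfolding bivariate_gaussian_def
  proof (intro allI)
    fix s t show "gaussian_rv M (\<lambda>\<omega>. s * Y \<omega> + t * X \<omega>)"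
      using gaussian_rv_lin[of t s] by (simp add: add.commute)
  qed
qed (use mean_X mean_Y var_X var_Y cov in \<open>simp_all add: mult.commute\<close>)

lemma uminus: "standard_gaussian_pair M (\<lambda>\<omega>. - X \<omega>) (\<lambda>\<omega>. - Y \<omega>) \<delta>"
proof
  show "bivariate_gaussian M (\<lambda>\<omega>. - X \<omega>) (\<lambda>\<omega>. - Y \<omega>)"
    unfolding bivariate_gaussian_def
  proof (intro allI)
    fix s t show "gaussian_rv M (\<lambda>\<omega>. s * - X \<omega> + t * - Y \<omega>)"
      using gaussian_rv_lin[of "- s" "- t"] by simp
  qed
qed (use mean_X mean_Y var_X var_Y cov in simp_all)

lemma prob_Y_le: "prob {\<omega> \<in> space M. Y \<omega> \<le> u} = 1 - normal_tail u"
  using std_normal_prob[OF Y_distributed, of "{..u}"] by (simp add: normal_tail_eq Phi_def cdf_def)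

text \<open>Symmetry of the law enters through the reflected pair: \<open>- Y\<close> is again
  standard normal.\<close>

lemma prob_Y_le_symmetric: "prob {\<omega> \<in> space M. Y \<omega> \<le> v} = normal_tail (- v)"
proof -
  interpret neg: standard_gaussian_pair M "\<lambda>\<omega>. - X \<omega>" "\<lambda>\<omega>. - Y \<omega>" \<delta> by (rule uminus)
  show ?thesis using std_normal_prob[OF neg.Y_distributed, of "{- v..}"]
    by (simp add: normal_tail_def)
qed

end

text \<open>After a change of sign the condition reads \<open>- Y \<omega> \<le> u\<close> and
  \<open>u \<le> - X \<omega>\<close>, an upward crossing of \<open>u\<close> by the reflected and
  exchanged pair.\<close>

lemma standard_gaussian_pair_lower_crossing:
  assumes "standard_gaussian_pair M X Y \<delta>" "0 \<le> \<delta>" "L > 0" "\<delta> \<le> 1 / L^5" "u \<ge> 0"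
  shows "measure M {\<omega> \<in> space M. X \<omega> \<le> - u \<and> - u \<le> Y \<omega>}
    \<le> 1 / L^2 * phi u + normal_tail ((u + 1) / sqrt (1 + 2 * (1 / L^3 + 1 / L)))"
proof -
  interpret standard_gaussian_pair M "\<lambda>\<omega>. - Y \<omega>" "\<lambda>\<omega>. - X \<omega>" \<delta>
    by (rule standard_gaussian_pair.uminus[OF standard_gaussian_pair.swap[OF assms(1)]])
  have "{\<omega> \<in> space M. X \<omega> \<le> - u \<and> - u \<le> Y \<omega>} = {\<omega> \<in> space M. - Y \<omega> \<le> u \<and> u \<le> - X \<omega>}"
    by auto
  then show ?thesis using crossing_le_log_scale[OF assms(2-5)] by simp
qed

lemma standard_gaussian_pairI:
  assumes "prob_space M" "bivariate_gaussian M X Y"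
    "(\<integral>\<omega>. X \<omega> \<partial>M) = 0" "(\<integral>\<omega>. Y \<omega> \<partial>M) = 0"
    "(\<integral>\<omega>. (X \<omega>)^2 \<partial>M) = 1" "(\<integral>\<omega>. (Y \<omega>)^2 \<partial>M) = 1"
    "correlation M X Y = 1 - \<delta>"
  shows "standard_gaussian_pair M X Y \<delta>"
  using assms
  by (simp add: standard_gaussian_pair_def standard_gaussian_pair_axioms_def correlation_def
      covariance_def power2_eq_square)

subsection \<open>Joint maxima and minima\<close>

text \<open>Unless some pair crosses \<open>u2\<close> or \<open>v2\<close>, the conditions on
  \<open>Y\<close> hold exactly when the same conditions on \<open>X\<close> do, and two conditions
  on \<open>X\<close> merge into one with the smaller threshold. A union bound over the crossings
  gives the error.\<close>

lemma (in prob_space) max_min_coupling: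
  fixes X Y :: "'i \<Rightarrow> 'a \<Rightarrow> real"
  assumes I: "finite I"
    and X [measurable]: "\<And>i. i \<in> I \<Longrightarrow> X i \<in> borel_measurable M"
    and Y [measurable]: "\<And>i. i \<in> I \<Longrightarrow> Y i \<in> borel_measurable M"
  shows "\<bar>prob {\<omega> \<in> space M. (\<forall>i\<in>I. X i \<omega> \<le> u1) \<and> (\<forall>i\<in>I. Y i \<omega> \<le> u2) \<and>
                (\<exists>i\<in>I. X i \<omega> \<le> v1) \<and> (\<exists>i\<in>I. Y i \<omega> \<le> v2)}
         - prob {\<omega> \<in> space M. (\<forall>i\<in>I. X i \<omega> \<le> min u1 u2) \<and> (\<exists>i\<in>I. X i \<omega> \<le> min v1 v2)}\<bar>
    \<le> (\<Sum>i\<in>I. (prob {\<omega> \<in> space M. X i \<omega> \<le> u2 \<and> u2 \<le> Y i \<omega>} + prob {\<omega> \<in> space M. Y i \<omega> \<le> u2 \<and> u2 \<le> X i \<omega>})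
            + (prob {\<omega> \<in> space M. X i \<omega> \<le> v2 \<and> v2 \<le> Y i \<omega>} + prob {\<omega> \<in> space M. Y i \<omega> \<le> v2 \<and> v2 \<le> X i \<omega>}))"
    (is "\<bar>prob ?E - prob ?F\<bar> \<le> (\<Sum>i\<in>I. ?r i)")
proof -
  have [measurable]: "Measurable.pred M (\<lambda>\<omega>. X i \<omega> \<le> c)" "Measurable.pred M (\<lambda>\<omega>. Y i \<omega> \<le> c)"
      "Measurable.pred M (\<lambda>\<omega>. c \<le> X i \<omega>)" "Measurable.pred M (\<lambda>\<omega>. c \<le> Y i \<omega>)" if "i \<in> I" for i c
    using X[OF that] Y[OF that] by measurable
  define C where "C i c = {\<omega> \<in> space M. X i \<omega> \<le> c \<and> c \<le> Y i \<omega>} \<union> {\<omega> \<in> space M. Y i \<omega> \<le> c \<and> c \<le> X i \<omega>}" for i c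
  have C [measurable]: "C i c \<in> events" if "i \<in> I" for i c
    unfolding C_def using that by measurable
  have C_le: "prob (C i c) \<le> prob {\<omega> \<in> space M. X i \<omega> \<le> c \<and> c \<le> Y i \<omega>} + prob {\<omega> \<in> space M. Y i \<omega> \<le> c \<and> c \<le> X i \<omega>}"
    if "i \<in> I" for i c
    unfolding C_def using that by (intro measure_Un_le) measurable
  define D where "D = (\<Union>i\<in>I. C i u2 \<union> C i v2)"
  have D [measurable]: "D \<in> events"
    unfolding D_def using I C by (intro sets.finite_UN sets.Un) auto
  have EF: "?E \<in> events" "?F \<in> events"
    by (intro sets.sets_Collect_conj sets.sets_Collect_finite_All sets.sets_Collect_finite_Ex I; measurable)+
  have off: "\<omega> \<in> ?E \<longleftrightarrow> \<omega> \<in> ?F" if \<omega>: "\<omega> \<in> space M" "\<omega> \<notin> D" for \<omega>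
  proof -
    have same: "X i \<omega> \<le> c \<longleftrightarrow> Y i \<omega> \<le> c" if "i \<in> I" "c \<in> {u2, v2}" for i c
      using \<omega> that by (auto simp: D_def C_def)
    have "(\<forall>i\<in>I. X i \<omega> \<le> u2) \<longleftrightarrow> (\<forall>i\<in>I. Y i \<omega> \<le> u2)" "(\<exists>i\<in>I. X i \<omega> \<le> v2) \<longleftrightarrow> (\<exists>i\<in>I. Y i \<omega> \<le> v2)"
      using same by auto
    \<comment> \<open>A value below the smaller threshold is also below the larger one, so one index
      witnesses both conditions.\<close>
    moreover have "(\<exists>i\<in>I. X i \<omega> \<le> v1) \<and> (\<exists>i\<in>I. X i \<omega> \<le> v2) \<longleftrightarrow> (\<exists>i\<in>I. X i \<omega> \<le> min v1 v2)"
    proof (cases v1 v2 rule: linorder_le_cases)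
      case le
      then show ?thesis by (auto simp: min_def intro: order_trans)
    next
      case ge
      then have "min v1 v2 = v2" by simp
      with ge show ?thesis by (auto intro: order_trans)
    qed
    ultimately show ?thesis using \<omega> by auto
  qed
  have "prob ?E \<le> prob (?F \<union> D)"
    using off by (intro finite_measure_mono sets.Un EF D) blast
  also have "\<dots> \<le> prob ?F + prob D" by (intro measure_Un_le EF D)
  finally have 1: "prob ?E \<le> prob ?F + prob D" .
  have "prob ?F \<le> prob (?E \<union> D)"
    using off by (intro finite_measure_mono sets.Un EF D) blast
  also have "\<dots> \<le> prob ?E + prob D" by (intro measure_Un_le EF D)
  finally have 2: "prob ?F \<le> prob ?E + prob D" .
  have "prob D \<le> (\<Sum>i\<in>I. prob (C i u2 \<union> C i v2))"
    unfolding D_def using I C by (intro finite_measure_subadditive_finite) auto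
  also have "\<dots> \<le> (\<Sum>i\<in>I. ?r i)"
  proof (rule sum_mono)
    fix i assume i: "i \<in> I"
    have "prob (C i u2 \<union> C i v2) \<le> prob (C i u2) + prob (C i v2)"
      using i by (intro measure_Un_le C)
    with C_le[OF i, of u2] C_le[OF i, of v2] show "prob (C i u2 \<union> C i v2) \<le> ?r i" by linarith
  qed
  finally show ?thesis using 1 2 by linarith
qed

text \<open>From the event that all values are at most \<open>u\<close>, remove the event that all
  lie in \<open>{v<..u}\<close>; by independence both have product form. The mass below
  \<open>v\<close> appears reflected, as \<open>normal_tail (- v)\<close>.\<close>

lemma (in prob_space) indep_max_min_prob:
  fixes X Y :: "'i \<Rightarrow> 'a \<Rightarrow> real"
  assumes I: "finite I" "I \<noteq> {}"
    and indep: "indep_vars (\<lambda>_. borel :: (real \<times> real) measure) (\<lambda>i \<omega>. (X i \<omega>, Y i \<omega>)) I"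
    and pair: "\<And>i. i \<in> I \<Longrightarrow> standard_gaussian_pair M (X i) (Y i) (\<delta> i)"
    and uv: "v \<le> u"
  shows "prob {\<omega> \<in> space M. (\<forall>i\<in>I. X i \<omega> \<le> u) \<and> (\<exists>i\<in>I. X i \<omega> \<le> v)}
    = (1 - normal_tail u) ^ card I - (1 - (normal_tail u + normal_tail (- v))) ^ card I"
proof -
  have [measurable]: "X i \<in> borel_measurable M" if "i \<in> I" for i
    using standard_gaussian_pair.measurable_X[OF pair[OF that]] .
  \<comment> \<open>Independence is assumed for the pairs; events on the first coordinate alone are
    preimages under \<open>fst\<close>.\<close>
  have prod: "prob {\<omega> \<in> space M. \<forall>i\<in>I. X i \<omega> \<in> A} = (\<Prod>i\<in>I. prob {\<omega> \<in> space M. X i \<omega> \<in> A})"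
    if [measurable]: "A \<in> sets borel" for A
  proof -
    have "fst -` A \<inter> space borel \<in> sets (borel :: (real \<times> real) measure)"
      by (intro measurable_sets[of fst borel borel] borel_measurable_continuous_onI
          continuous_intros that)
    then have S: "fst -` A \<in> sets (borel :: (real \<times> real) measure)" by simp
    have "prob (\<Inter>i\<in>I. (\<lambda>\<omega>. (X i \<omega>, Y i \<omega>)) -` (fst -` A) \<inter> space M)
        = (\<Prod>i\<in>I. prob ((\<lambda>\<omega>. (X i \<omega>, Y i \<omega>)) -` (fst -` A) \<inter> space M))"
      by (rule indep_varsD_finite[OF indep I(2,1) S])
    moreover have "(\<Inter>i\<in>I. (\<lambda>\<omega>. (X i \<omega>, Y i \<omega>)) -` (fst -` A) \<inter> space M) = {\<omega> \<in> space M. \<forall>i\<in>I. X i \<omega> \<in> A}"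
      using I by auto
    moreover have "(\<lambda>\<omega>. (X i \<omega>, Y i \<omega>)) -` (fst -` A) \<inter> space M = {\<omega> \<in> space M. X i \<omega> \<in> A}" for i
      by auto
    ultimately show ?thesis by simp
  qed
  have le: "prob {\<omega> \<in> space M. X i \<omega> \<le> u} = 1 - normal_tail u"
    and le': "prob {\<omega> \<in> space M. X i \<omega> \<le> v} = normal_tail (- v)" if "i \<in> I" for i
    using standard_gaussian_pair.prob_Y_le[OF standard_gaussian_pair.swap[OF pair[OF that]]]
      standard_gaussian_pair.prob_Y_le_symmetric[OF standard_gaussian_pair.swap[OF pair[OF that]]] by auto
  have between: "prob {\<omega> \<in> space M. X i \<omega> \<in> {v<..u}} = 1 - (normal_tail u + normal_tail (- v))"
    if i: "i \<in> I" for i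
  proof -
    have eq: "{\<omega> \<in> space M. X i \<omega> \<in> {v<..u}} = {\<omega> \<in> space M. X i \<omega> \<le> u} - {\<omega> \<in> space M. X i \<omega> \<le> v}"
      by auto
    have "{\<omega> \<in> space M. X i \<omega> \<le> c} \<in> events" for c
      using i by measurable
    moreover have "{\<omega> \<in> space M. X i \<omega> \<le> v} \<subseteq> {\<omega> \<in> space M. X i \<omega> \<le> u}"
      using uv by auto
    ultimately have "prob {\<omega> \<in> space M. X i \<omega> \<in> {v<..u}}
        = prob {\<omega> \<in> space M. X i \<omega> \<le> u} - prob {\<omega> \<in> space M. X i \<omega> \<le> v}"
      unfolding eq by (intro finite_measure_Diff)
    then show ?thesis using le[OF i] le'[OF i] by simp
  qed
  have E: "{\<omega> \<in> space M. \<forall>i\<in>I. X i \<omega> \<in> {..u}} \<in> events" "{\<omega> \<in> space M. \<forall>i\<in>I. X i \<omega> \<in> {v<..u}} \<in> events"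
    using I by (intro sets.sets_Collect_finite_All; measurable)+
  have eq: "{\<omega> \<in> space M. (\<forall>i\<in>I. X i \<omega> \<le> u) \<and> (\<exists>i\<in>I. X i \<omega> \<le> v)}
      = {\<omega> \<in> space M. \<forall>i\<in>I. X i \<omega> \<in> {..u}} - {\<omega> \<in> space M. \<forall>i\<in>I. X i \<omega> \<in> {v<..u}}"
    by (auto simp: not_less)
  have "prob {\<omega> \<in> space M. (\<forall>i\<in>I. X i \<omega> \<le> u) \<and> (\<exists>i\<in>I. X i \<omega> \<le> v)}
      = prob {\<omega> \<in> space M. \<forall>i\<in>I. X i \<omega> \<in> {..u}} - prob {\<omega> \<in> space M. \<forall>i\<in>I. X i \<omega> \<in> {v<..u}}"
    unfolding eq by (rule finite_measure_Diff[OF E]) auto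
  also have "\<dots> = (1 - normal_tail u) ^ card I - (1 - (normal_tail u + normal_tail (- v))) ^ card I"
  proof -
    have "prob {\<omega> \<in> space M. \<forall>i\<in>I. X i \<omega> \<in> {..u}} = (\<Prod>i\<in>I. 1 - normal_tail u)"
      by (rule trans[OF prod prod.cong]) (use le in auto)
    moreover have "prob {\<omega> \<in> space M. \<forall>i\<in>I. X i \<omega> \<in> {v<..u}}
        = (\<Prod>i\<in>I. 1 - (normal_tail u + normal_tail (- v)))"
      by (rule trans[OF prod prod.cong]) (use between in \<open>blast | simp\<close>)+
    ultimately show ?thesis by simp
  qed
  finally show ?thesis .
qed

section \<open>Transfer to the triangular array and identification of the limit\<close>

theorem theorem3:
  fixes n0 :: nat
    and M :: "nat \<Rightarrow> 'a measure"
    and \<xi> \<eta> :: "nat \<Rightarrow> nat \<Rightarrow> 'a \<Rightarrow> real"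
    and m :: "nat \<Rightarrow> real \<Rightarrow> real"
    and b :: "nat \<Rightarrow> real"
    and P :: "nat \<Rightarrow> real"
    and x1 y1 x2 y2 :: real
  assumes n0: "n0 \<ge> 3"
    and prob: "\<And>n. n \<ge> n0 \<Longrightarrow> prob_space (M n)"
    and indep: "\<And>n. n \<ge> n0 \<Longrightarrow>
      prob_space.indep_vars (M n) (\<lambda>_. borel :: (real \<times> real) measure)
        (\<lambda>i \<omega>. (\<xi> n i \<omega>, \<eta> n i \<omega>)) {1..n}"
    and gauss: "\<And>n i. n \<ge> n0 \<Longrightarrow> i \<in> {1..n} \<Longrightarrow> bivariate_gaussian (M n) (\<xi> n i) (\<eta> n i)"
    and mean_xi: "\<And>n i. n \<ge> n0 \<Longrightarrow> i \<in> {1..n} \<Longrightarrow> (\<integral>\<omega>. \<xi> n i \<omega> \<partial>M n) = 0"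
    and mean_eta: "\<And>n i. n \<ge> n0 \<Longrightarrow> i \<in> {1..n} \<Longrightarrow> (\<integral>\<omega>. \<eta> n i \<omega> \<partial>M n) = 0"
    and var_xi: "\<And>n i. n \<ge> n0 \<Longrightarrow> i \<in> {1..n} \<Longrightarrow> (\<integral>\<omega>. (\<xi> n i \<omega>)\<^sup>2 \<partial>M n) = 1"
    and var_eta: "\<And>n i. n \<ge> n0 \<Longrightarrow> i \<in> {1..n} \<Longrightarrow> (\<integral>\<omega>. (\<eta> n i \<omega>)\<^sup>2 \<partial>M n) = 1"
    and corr: "\<And>n i. n \<ge> n0 \<Longrightarrow> i \<in> {1..n} \<Longrightarrow>
      correlation (M n) (\<xi> n i) (\<eta> n i) = 1 - m n (real i / real n) / ln (real n)"
    and m_pos: "\<And>n t. n \<ge> n0 \<Longrightarrow> t \<in> {0..1} \<Longrightarrow> m n t > 0"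
    and m_le: "\<And>n i. n \<ge> n0 \<Longrightarrow> i \<in> {1..n} \<Longrightarrow> m n (real i / real n) \<le> 2 * ln (real n)"
    and m_lim: "(\<lambda>n. (ln (real n)) ^ 4 * Max ((\<lambda>i. m n (real i / real n)) ` {1..n})) \<longlonglongrightarrow> 0"
    and b: "\<And>n. n \<ge> n0 \<Longrightarrow> 1 - Phi (b n) = 1 / real n"
    and P: "\<And>n. n \<ge> n0 \<Longrightarrow> P n = measure (M n) {\<omega> \<in> space (M n).
      Max ((\<lambda>i. \<xi> n i \<omega>) ` {1..n}) \<le> b n + x2 / b n \<and>
      Max ((\<lambda>i. \<eta> n i \<omega>) ` {1..n}) \<le> b n + y2 / b n \<and>
      Min ((\<lambda>i. \<xi> n i \<omega>) ` {1..n}) \<le> - b n + x1 / b n \<and>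
      Min ((\<lambda>i. \<eta> n i \<omega>) ` {1..n}) \<le> - b n + y1 / b n}"
  shows "(\<lambda>n. 4 * ln (real n) * (P n - H0 x2 y2 * H0_tilde x1 y1)) \<longlonglongrightarrow>
      ((min x2 y2)\<^sup>2 + 2 * min x2 y2) * exp (- min x2 y2) * H0 x2 y2 * H0_tilde x1 y1
      - ((x1\<^sup>2 - 2 * x1) * exp x1 * Gumbel (- x1) + (y1\<^sup>2 - 2 * y1) * exp y1 * Gumbel (- y1)) * H0 x2 y2
      + ((max x1 y1)\<^sup>2 - 2 * max x1 y1) * exp (max x1 y1) * H0 x2 y2 * H0 (- x1) (- y1)"
proof -
  define L where "L n = ln (real n)" for n :: nat
  \<comment> \<open>After the replacement the smaller threshold on each side survives. For the
    minima this gives \<open>min x1 y1\<close>; the maximum in the claim comes from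
    inclusion-exclusion.\<close>
  define x where "x = min x2 y2"
  define z where "z = min x1 y1"
  define \<delta> where "\<delta> n i = m n (real i / real n) / L n" for n i
  define c where "c n w = 1 / L n^2 * phi (b n + w / b n)
      + normal_tail ((b n + w / b n + 1) / sqrt (1 + 2 * (1 / L n^3 + 1 / L n)))" for n w
  define P0 where "P0 n = (1 - normal_tail (b n + x / b n)) ^ n
      - (1 - (normal_tail (b n + x / b n) + normal_tail (b n - z / b n))) ^ n" for n
  interpret gumbel_norming b
    by unfold_locales (use eventually_ge_at_top[of n0] in \<open>eventually_elim, simp add: normal_tail_eq b\<close>)
  have pair: "standard_gaussian_pair (M n) (\<xi> n i) (\<eta> n i) (\<delta> n i)" if "n \<ge> n0" "i \<in> {1..n}" for n i
    using that by (intro standard_gaussian_pairI) (simp_all add: prob gauss mean_xi mean_eta var_xi var_eta corr \<delta>_def L_def)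
  have pos: "\<forall>\<^sub>F n in sequentially. b n + w / b n > 0" for w
  proof -
    have "filterlim (\<lambda>n. b n + w / b n) at_top sequentially"
      by (rule filterlim_compose[OF _ filterlim_b]) real_asymp
    then show ?thesis by (simp add: filterlim_at_top_dense)
  qed
  have b_pos: "\<forall>\<^sub>F n in sequentially. b n > 0"
    using filterlim_b by (simp add: filterlim_at_top_dense)
  \<comment> \<open>Eventually the lower threshold is negative and the upper one positive; the
    formula behind \<open>P0\<close> needs them in this order.\<close>
  have ordered: "\<forall>\<^sub>F n in sequentially. - b n + z / b n \<le> b n + x / b n"
    using pos[of x] pos[of "- z"] by eventually_elim simp
  \<comment> \<open>Together with the one further factor \<open>1 / L n\<close> in the correlation
    this gives \<open>\<delta> n i \<le> 1 / L n^5\<close>.\<close>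
  have m_small: "\<forall>\<^sub>F n in sequentially. L n^4 * Max ((\<lambda>i. m n (real i / real n)) ` {1..n}) < 1"
    unfolding L_def by (rule order_tendstoD(2)[OF m_lim]) simp
  \<comment> \<open>Each index contributes two crossings at either level; the scale
    \<open>4 * L n\<close> turns this into the factor \<open>8\<close>.\<close>
  have near: "\<forall>\<^sub>F n in sequentially. norm (4 * L n * (P n - P0 n))
      \<le> 8 * (real n * L n * c n y2) + 8 * (real n * L n * c n (- y1))"
    using eventually_ge_at_top[of n0] b_pos pos[of y2] pos[of "- y1"] ordered m_small
  proof eventually_elim
    case (elim n)
    have n: "n \<ge> n0" "n \<ge> 3" using elim n0 by auto
    then have I: "finite {1..n}" "{1..n} \<noteq> {}" by auto
    have L: "L n > 0" using n by (simp add: L_def)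
    have b0: "b n > 0" using elim by simp
    interpret prob_space "M n" using prob n by blast
    have \<delta>: "0 \<le> \<delta> n i" "\<delta> n i \<le> 1 / L n^5" if i: "i \<in> {1..n}" for i
    proof -
      have "real i / real n \<in> {0..1}" using i by simp
      from m_pos[OF n(1) this] show "0 \<le> \<delta> n i" using L by (simp add: \<delta>_def)
      have "m n (real i / real n) \<le> Max ((\<lambda>i. m n (real i / real n)) ` {1..n})"
        using i by (intro Max_ge) auto
      then have "L n^4 * m n (real i / real n) \<le> L n^4 * Max ((\<lambda>i. m n (real i / real n)) ` {1..n})"
        using L by (intro mult_left_mono) auto
      then have "L n^4 * m n (real i / real n) \<le> 1" using elim by linarith
      then show "\<delta> n i \<le> 1 / L n^5" using L by (simp add: \<delta>_def field_simps eval_nat_numeral)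
    qed
    let ?\<Omega> = "space (M n)"
    have up: "prob {\<omega> \<in> ?\<Omega>. \<xi> n i \<omega> \<le> b n + y2 / b n \<and> b n + y2 / b n \<le> \<eta> n i \<omega>} \<le> c n y2"
      "prob {\<omega> \<in> ?\<Omega>. \<eta> n i \<omega> \<le> b n + y2 / b n \<and> b n + y2 / b n \<le> \<xi> n i \<omega>} \<le> c n y2"
      if i: "i \<in> {1..n}" for i
      unfolding c_def
      using standard_gaussian_pair.crossing_le_log_scale[OF pair[OF n(1) i] \<delta>(1)[OF i] L \<delta>(2)[OF i] less_imp_le]
        standard_gaussian_pair.crossing_le_log_scale[OF standard_gaussian_pair.swap[OF pair[OF n(1) i]] \<delta>(1)[OF i] L \<delta>(2)[OF i] less_imp_le]
        elim by blast+
    \<comment> \<open>The lower threshold is the reflection of an upper threshold with parameter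
      \<open>- y1\<close>, which is why \<open>c\<close> is evaluated there.\<close>
    have lower_eq: "- b n + y1 / b n = - (b n + - y1 / b n)" by simp
    have low: "prob {\<omega> \<in> ?\<Omega>. \<xi> n i \<omega> \<le> - b n + y1 / b n \<and> - b n + y1 / b n \<le> \<eta> n i \<omega>} \<le> c n (- y1)"
      "prob {\<omega> \<in> ?\<Omega>. \<eta> n i \<omega> \<le> - b n + y1 / b n \<and> - b n + y1 / b n \<le> \<xi> n i \<omega>} \<le> c n (- y1)"
      if i: "i \<in> {1..n}" for i
      unfolding c_def lower_eq
      using standard_gaussian_pair_lower_crossing[OF pair[OF n(1) i] \<delta>(1)[OF i] L \<delta>(2)[OF i] less_imp_le]
        standard_gaussian_pair_lower_crossing[OF standard_gaussian_pair.swap[OF pair[OF n(1) i]] \<delta>(1)[OF i] L \<delta>(2)[OF i] less_imp_le]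
        elim by blast+
    have min_u: "min (b n + x2 / b n) (b n + y2 / b n) = b n + x / b n"
      using b0 by (auto simp: x_def min_def divide_le_cancel)
    have min_v: "min (- b n + x1 / b n) (- b n + y1 / b n) = - b n + z / b n"
      using b0 by (auto simp: z_def min_def divide_le_cancel)
    have P_eq: "P n = prob {\<omega> \<in> ?\<Omega>. (\<forall>i\<in>{1..n}. \<xi> n i \<omega> \<le> b n + x2 / b n) \<and> (\<forall>i\<in>{1..n}. \<eta> n i \<omega> \<le> b n + y2 / b n) \<and>
        (\<exists>i\<in>{1..n}. \<xi> n i \<omega> \<le> - b n + x1 / b n) \<and> (\<exists>i\<in>{1..n}. \<eta> n i \<omega> \<le> - b n + y1 / b n)}"
      unfolding P[OF n(1)] using I by (simp add: Max_le_iff Min_le_iff del: atLeastAtMost_iff)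
    have P0_eq: "P0 n = prob {\<omega> \<in> ?\<Omega>. (\<forall>i\<in>{1..n}. \<xi> n i \<omega> \<le> b n + x / b n) \<and>
        (\<exists>i\<in>{1..n}. \<xi> n i \<omega> \<le> - b n + z / b n)}"
      using indep_max_min_prob[OF I indep[OF n(1)] pair[OF n(1)], of "- b n + z / b n" "b n + x / b n"] elim
      by (simp add: P0_def)
    have "\<bar>P n - P0 n\<bar> \<le> (\<Sum>i\<in>{1..n}.
        (prob {\<omega> \<in> ?\<Omega>. \<xi> n i \<omega> \<le> b n + y2 / b n \<and> b n + y2 / b n \<le> \<eta> n i \<omega>}
         + prob {\<omega> \<in> ?\<Omega>. \<eta> n i \<omega> \<le> b n + y2 / b n \<and> b n + y2 / b n \<le> \<xi> n i \<omega>})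
        + (prob {\<omega> \<in> ?\<Omega>. \<xi> n i \<omega> \<le> - b n + y1 / b n \<and> - b n + y1 / b n \<le> \<eta> n i \<omega>}
         + prob {\<omega> \<in> ?\<Omega>. \<eta> n i \<omega> \<le> - b n + y1 / b n \<and> - b n + y1 / b n \<le> \<xi> n i \<omega>}))"
      unfolding P_eq P0_eq min_u[symmetric] min_v[symmetric]
      by (rule max_min_coupling)
         (use pair[OF n(1)] standard_gaussian_pair.measurable_X standard_gaussian_pair.measurable_Y I in blast)+
    also have "\<dots> \<le> (\<Sum>i\<in>{1..n}. (c n y2 + c n y2) + (c n (- y1) + c n (- y1)))"
      by (intro sum_mono add_mono up low)
    also have "\<dots> = real n * (2 * c n y2 + 2 * c n (- y1))" by simp
    finally have "4 * L n * \<bar>P n - P0 n\<bar> \<le> 4 * L n * (real n * (2 * c n y2 + 2 * c n (- y1)))"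
      using L by (intro mult_left_mono) auto
    moreover have "norm (4 * L n * (P n - P0 n)) = 4 * L n * \<bar>P n - P0 n\<bar>"
      using L by (simp add: abs_mult)
    ultimately show ?case by (simp add: algebra_simps)
  qed
  have "(\<lambda>n. 8 * (real n * L n * c n y2) + 8 * (real n * L n * c n (- y1))) \<longlonglongrightarrow> 8 * 0 + 8 * 0"
    unfolding c_def L_def
    by (intro tendsto_add tendsto_mult tendsto_const crossing_bound_negligible)
  then have "(\<lambda>n. 8 * (real n * L n * c n y2) + 8 * (real n * L n * c n (- y1))) \<longlonglongrightarrow> 0" by simp
  with near have diff: "(\<lambda>n. 4 * L n * (P n - P0 n)) \<longlonglongrightarrow> 0"
    by (rule Lim_null_comparison)
  define G where "G = exp (- exp (- x)) - exp (- (exp (- x) + exp z))"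
  \<comment> \<open>The replacement error and the two expansions add up to
    \<open>4 * L n * (P n - G)\<close>.\<close>
  have "(\<lambda>n. 4 * L n * (P n - P0 n) + (4 * L n * ((1 - normal_tail (b n + x / b n)) ^ n - exp (- exp (- x)))
      - 4 * L n * ((1 - (normal_tail (b n + x / b n) + normal_tail (b n - z / b n))) ^ n - exp (- (exp (- x) + exp z)))))
    \<longlonglongrightarrow> 0 + ((x^2 + 2 * x) * exp (- x) * exp (- exp (- x))
      - ((x^2 + 2 * x) * exp (- x) + (z^2 - 2 * z) * exp z) * exp (- (exp (- x) + exp z)))"
    unfolding L_def
    by (intro tendsto_add tendsto_diff diff[unfolded L_def] max_expansion max_min_expansion)
  then have lim: "(\<lambda>n. 4 * ln (real n) * (P n - G)) \<longlonglongrightarrow> (x^2 + 2 * x) * exp (- x) * exp (- exp (- x))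
      - ((x^2 + 2 * x) * exp (- x) + (z^2 - 2 * z) * exp z) * exp (- (exp (- x) + exp z))"
    by (simp add: L_def P0_def G_def algebra_simps)
  have H: "H0 x2 y2 = exp (- exp (- x))" by (simp add: H0_def Gumbel_def x_def)
  \<comment> \<open>Inclusion-exclusion collapses: \<open>Gumbel (min (- x1) (- y1))\<close> cancels
    the term of the larger of \<open>x1\<close> and \<open>y1\<close>, and only that of the smaller
    remains.\<close>
  have H': "H0_tilde x1 y1 = 1 - exp (- exp z)"
    by (cases "x1 \<le> y1") (simp_all add: H0_tilde_def Gumbel_def z_def min_def)
  have split: "exp (- (exp (- x) + exp z)) = H0 x2 y2 * exp (- exp z)"
    unfolding H by (simp flip: exp_add)
  have G: "G = H0 x2 y2 * H0_tilde x1 y1"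
    unfolding G_def split H' H by (simp add: algebra_simps)
  \<comment> \<open>The same cancellation among the correction terms: the summand of the larger of
    \<open>x1\<close> and \<open>y1\<close> drops out.\<close>
  have low: "((x1\<^sup>2 - 2 * x1) * exp x1 * Gumbel (- x1) + (y1\<^sup>2 - 2 * y1) * exp y1 * Gumbel (- y1))
      - ((max x1 y1)\<^sup>2 - 2 * max x1 y1) * exp (max x1 y1) * H0 (- x1) (- y1)
      = (z^2 - 2 * z) * exp z * exp (- exp z)"
    by (cases "x1 \<le> y1") (auto simp: H0_def Gumbel_def z_def min_def max_def)
  have "(x^2 + 2 * x) * exp (- x) * exp (- exp (- x))
      - ((x^2 + 2 * x) * exp (- x) + (z^2 - 2 * z) * exp z) * exp (- (exp (- x) + exp z))
    = (x^2 + 2 * x) * exp (- x) * H0 x2 y2 * H0_tilde x1 y1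
      - H0 x2 y2 * ((z^2 - 2 * z) * exp z * exp (- exp z))"
    unfolding split H[symmetric] H' by (simp add: algebra_simps)
  also have "\<dots> = (x^2 + 2 * x) * exp (- x) * H0 x2 y2 * H0_tilde x1 y1
      - ((x1\<^sup>2 - 2 * x1) * exp x1 * Gumbel (- x1) + (y1\<^sup>2 - 2 * y1) * exp y1 * Gumbel (- y1)) * H0 x2 y2
      + ((max x1 y1)\<^sup>2 - 2 * max x1 y1) * exp (max x1 y1) * H0 x2 y2 * H0 (- x1) (- y1)"
    unfolding low[symmetric] by (simp add: algebra_simps)
  finally show ?thesis using lim unfolding G x_def by (rule tendsto_eq_rhs[rotated])
qed

end
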